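(* Let $n\ge 1$ and let $f$ be a homogeneous polynomial of degree $d\ge2$ in $R=\mathbb{C}[x_0,\dots,x_n]$. (1) If the hypersurface $V(f)\subset\mathbb{P}^n$ is smooth, then $\operatorname{hess}_f\notin J(f)$. (2) If the hypersurface $V(f)$ is not smooth, but has isolated singularities, then $\operatorname{hess}_f\in J(f)$.
   Context: $J(f)\subset R$ is the Jacobian ideal, generated by the partial derivatives $\partial f/\partial x_i$, $i=0,\dots,n$, and $\operatorname{hess}_f=\det\left(\frac{\partial^2 f}{\partial x_i\partial x_j}\right)_{0\le i,j\le n}$ is the Hessian of $f$. *)

theory Defs
  imports "HOL-Analysis.Analysis" "HOL-Library.Poly_Mapping"
begin

text \<open>
  Polynomials over the complex numbers in the variables \<open>x\<^sub>i\<close>, where \<open>i\<close> ranges over the finite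
  type \<open>'n\<close>. The keys of the outer mapping are exponent vectors, its values are coefficients, and
  multiplication is the convolution product of \<^theory>\<open>HOL-Library.Poly_Mapping\<close>.
\<close>

type_synonym 'n cpoly = "('n \<Rightarrow>\<^sub>0 nat) \<Rightarrow>\<^sub>0 complex"

text \<open>
  The zero polynomial counts as homogeneous of every degree.
\<close>

definition homogeneous_poly :: "nat \<Rightarrow> ('n::finite) cpoly \<Rightarrow> bool" where
  "homogeneous_poly d f \<longleftrightarrow>
     (\<forall>m \<in> Poly_Mapping.keys f. (\<Sum>i\<in>UNIV. Poly_Mapping.lookup m i) = d)"

definition eval_poly :: "('n::finite) cpoly \<Rightarrow> complex ^ 'n \<Rightarrow> complex" where
  "eval_poly f v =
     (\<Sum>m \<in> Poly_Mapping.keys f.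
        Poly_Mapping.lookup f m * (\<Prod>i\<in>UNIV. (v $ i) ^ Poly_Mapping.lookup m i))"

text \<open>
  Exponents are subtracted in \<open>nat\<close>, so the truncating case \<open>m\<^sub>i = 0\<close> is harmless: there
  the coefficient vanishes.
\<close>

definition partial_deriv :: "'n::finite \<Rightarrow> 'n cpoly \<Rightarrow> 'n cpoly" where
  "partial_deriv i f =
     (\<Sum>m \<in> Poly_Mapping.keys f.
        Poly_Mapping.single (m - Poly_Mapping.single i 1)
          (of_nat (Poly_Mapping.lookup m i) * Poly_Mapping.lookup f m))"

definition jacobian_ideal :: "('n::finite) cpoly \<Rightarrow> 'n cpoly set" where
  "jacobian_ideal f = {(\<Sum>i\<in>UNIV. g i * partial_deriv i f) | g. True}"

definition hessian_poly :: "('n::finite) cpoly \<Rightarrow> 'n cpoly" where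
  "hessian_poly f = det (\<chi> i j. partial_deriv i (partial_deriv j f))"

text \<open>
  The complex projective space of lines in \<open>complex ^ 'n\<close>, of dimension \<open>CARD('n) - 1\<close>. A point
  is the set of all its homogeneous coordinate vectors.
\<close>

definition proj_rel :: "((complex ^ 'n::finite) \<times> (complex ^ 'n)) set" where
  "proj_rel = {(v, w). v \<noteq> 0 \<and> w \<noteq> 0 \<and> (\<exists>c. c \<noteq> 0 \<and> w = c *s v)}"

definition proj_space :: "(complex ^ 'n::finite) set set" where
  "proj_space = (- {0}) // proj_rel"

text \<open>
  The quotient topology: a set of points is open iff the set of all coordinate vectors of its
  points is open. Since the singular locus is Zariski closed, its isolated points in this
  topology and in the Zariski topology are the same.
\<close>

definition proj_topology :: "(complex ^ 'n::finite) set topology" where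
  "proj_topology = topology (\<lambda>U. U \<subseteq> proj_space \<and> open (\<Union>U))"

text \<open>
  The singular points of the hypersurface \<open>V(f)\<close> as the scheme defined by \<open>f\<close> (not by
  its radical), given by the Jacobian criterion: points on multiple components are singular.
\<close>

definition singular_locus :: "('n::finite) cpoly \<Rightarrow> (complex ^ 'n) set set" where
  "singular_locus f =
     {p \<in> proj_space. \<forall>v\<in>p. eval_poly f v = 0 \<and> (\<forall>i. eval_poly (partial_deriv i f) v = 0)}"

definition smooth_hypersurface :: "('n::finite) cpoly \<Rightarrow> bool" where
  "smooth_hypersurface f \<longleftrightarrow> singular_locus f = {}"

definition has_isolated_singularities :: "('n::finite) cpoly \<Rightarrow> bool" where
  "has_isolated_singularities f \<longleftrightarrow>
     (\<forall>p \<in> singular_locus f. \<exists>U. openin proj_topology U \<and> U \<inter> singular_locus f = {p})"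

lemma equiv_proj_rel: "equiv (- {0}) (proj_rel :: ((complex ^ 'n::finite) \<times> _) set)"
proof (rule equivI)
  show "proj_rel \<subseteq> (- {0}) \<times> (- {0 :: complex ^ 'n})"
    by (auto simp: proj_rel_def)
  show "refl_on (- {0 :: complex ^ 'n}) proj_rel"
    by (auto simp: refl_on_def proj_rel_def intro!: exI[of _ 1])
  show "sym (proj_rel :: ((complex ^ 'n) \<times> _) set)"
  proof (rule symI)
    fix v w :: "complex ^ 'n" assume "(v, w) \<in> proj_rel"
    then obtain c where "v \<noteq> 0" "w \<noteq> 0" "c \<noteq> 0" "w = c *s v"
      by (auto simp: proj_rel_def)
    then have "v = inverse c *s w" "inverse c \<noteq> 0"
      by (simp_all add: vector_smult_assoc)
    with \<open>v \<noteq> 0\<close> \<open>w \<noteq> 0\<close> show "(w, v) \<in> proj_rel"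
      unfolding proj_rel_def by blast
  qed
  show "trans (proj_rel :: ((complex ^ 'n) \<times> _) set)"
  proof (rule transI)
    fix u v w :: "complex ^ 'n" assume "(u, v) \<in> proj_rel" "(v, w) \<in> proj_rel"
    then obtain b c where "u \<noteq> 0" "w \<noteq> 0" "b \<noteq> 0" "c \<noteq> 0" "v = b *s u" "w = c *s v"
      unfolding proj_rel_def by blast
    then have "w = (c * b) *s u" "c * b \<noteq> 0"
      by (simp_all add: vector_smult_assoc)
    with \<open>u \<noteq> 0\<close> \<open>w \<noteq> 0\<close> show "(u, w) \<in> proj_rel"
      unfolding proj_rel_def by blast
  qed
qed

lemma openin_proj_topology:
  fixes U :: "(complex ^ 'n::finite) set set"
  shows "openin proj_topology U \<longleftrightarrow> U \<subseteq> proj_space \<and> open (\<Union>U)"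
proof -
  have "istopology (\<lambda>U :: (complex ^ 'n) set set. U \<subseteq> proj_space \<and> open (\<Union>U))"
    unfolding istopology_def
  proof (intro conjI allI impI)
    fix S T :: "(complex ^ 'n) set set"
    assume S: "S \<subseteq> proj_space \<and> open (\<Union>S)" and T: "T \<subseteq> proj_space \<and> open (\<Union>T)"
    have disj: "X = Y" if "X \<in> S" "Y \<in> T" "x \<in> X" "x \<in> Y" for X Y x
      using quotient_disj[OF equiv_proj_rel, of X Y] that S T
      unfolding proj_space_def by blast
    have "\<Union>(S \<inter> T) = \<Union>S \<inter> \<Union>T"
      using disj by blast
    with S T show "open (\<Union>(S \<inter> T))"
      by (simp add: open_Int)
    show "S \<inter> T \<subseteq> proj_space" using S by blast
  next
    fix K :: "(complex ^ 'n) set set set"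
    assume K: "\<forall>S\<in>K. S \<subseteq> proj_space \<and> open (\<Union>S)"
    then show "\<Union>K \<subseteq> proj_space" by blast
    have "\<Union>(\<Union>K) = (\<Union>S\<in>K. \<Union>S)" by blast
    with K show "open (\<Union>(\<Union>K))" by auto
  qed
  then show ?thesis
    unfolding proj_topology_def by (simp add: topology_inverse')
qed

lemma topspace_proj_topology:
  "topspace proj_topology = (proj_space :: (complex ^ 'n::finite) set set)"
proof -
  have "\<Union>(proj_space :: (complex ^ 'n) set set) = - {0}"
    unfolding proj_space_def by (rule Union_quotient[OF equiv_proj_rel])
  then have "openin proj_topology (proj_space :: (complex ^ 'n) set set)"
    by (simp add: openin_proj_topology open_Compl)
  then show ?thesis
    by (metis openin_proj_topology openin_subset openin_topspace subset_antisym)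
qed

end

theory Submission
  imports Defs
begin

text \<open>
  Let \<open>f\<^sub>i\<close> be the partial derivatives of \<open>f\<close>, \<open>J = (f\<^sub>i)\<close> the Jacobian ideal and \<open>H\<close> the Hessian
  matrix, and write \<open>d = e + 2\<close>. The polynomials \<open>f\<^sub>i\<close> are homogeneous of degree \<open>e + 1\<close>, and by
  Euler's identity \<open>V(f)\<close> is smooth iff they have no common zero except the origin.

  Singular case. Euler's identity for the \<open>f\<^sub>i\<close> reads \<open>H x = (e + 1) (f\<^sub>i)\<^sub>i\<close>. So \<open>H\<close> is one of the
  matrices \<open>B\<close> of forms of degree \<open>e\<close> with \<open>B x = (e + 1) (f\<^sub>i)\<^sub>i\<close>, and the determinants of any
  two such matrices agree modulo \<open>J\<close> (\<open>det_transition_matrix_unique\<close>). Indeed two rows with the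
  same image differ by a linear syzygy of the variables, which is a combination of the Koszul
  syzygies \<open>x\<^sub>j e\<^sub>k - x\<^sub>k e\<^sub>j\<close>, and a determinant with a Koszul row lies in the ideal generated by
  the other entries of \<open>B x\<close>, by a cofactor identity. If all \<open>f\<^sub>i\<close> vanish at \<open>v \<noteq> 0\<close>, then \<open>B\<close> can
  be chosen with \<open>B v = 0\<close> (\<open>vanishing_at_point_transition\<close>), so \<open>det B = 0\<close> and \<open>det H\<close> lies in
  \<open>J\<close>.

  Smooth case. Let \<open>F = (f\<^sub>i)\<^sub>i\<close> as a map of affine space into itself, and let \<open>h = det H\<close> be its
  Jacobian determinant. An analytic form of the Grothendieck residue separates \<open>h\<close> from \<open>J\<close>:
  the functional that sends \<open>g\<close> to the integral over all of affine space of \<open>g \<phi>'(|F|\<^sup>2)\<close> times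
  the conjugate of \<open>h\<close>, where \<open>\<phi>\<close> is \<open>C\<^sup>1\<close> and vanishes for large arguments, so that the
  integrand has compact support.
  It vanishes on \<open>J\<close>: for \<open>g = q f\<^sub>i\<close> the integrand is the sum over \<open>k\<close> of the derivatives with
  respect to the conjugate of \<open>x\<^sub>k\<close> of \<open>q\<close> times the conjugate of the \<open>(i, k)\<close> cofactor of \<open>H\<close> times
  \<open>\<phi>(|F|\<^sup>2)\<close>, because the rows of the cofactor matrix of a Jacobian matrix are divergence free
  (\<open>jacobian_cofactor_divergence_free\<close>). On \<open>h\<close> itself it is the integral of \<open>|h|\<^sup>2 \<phi>'(|F|\<^sup>2)\<close>,
  which is nonzero for a monotone \<open>\<phi>\<close> unless \<open>h\<close> vanishes where \<open>\<phi>' \<noteq> 0\<close>.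

  It remains to see that \<open>h\<close> is not identically zero (\<open>jacobian_not_identically_zero\<close>). Since
  \<open>|F|\<^sup>2\<close> grows at least like \<open>c |x|\<^sup>2\<close>, the function \<open>(c/2) |x|\<^sup>2 - |F|\<^sup>2\<close> has a maximum. At a
  maximum the Jacobian matrix is invertible: along a complex line in a kernel direction \<open>|F|\<^sup>2\<close>
  has Laplacian zero at that point, whereas \<open>|x|\<^sup>2\<close> has positive Laplacian.
\<close>

section \<open>Determinants over a commutative ring\<close>

definition upd_row :: "'a ^ 'm ^ 'n \<Rightarrow> 'n::finite \<Rightarrow> 'a ^ 'm \<Rightarrow> 'a ^ 'm ^ 'n" where
  "upd_row M i w = (\<chi> r. if r = i then w else M $ r)"

lemma upd_row_nth: "upd_row M i w $ r = (if r = i then w else M $ r)"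
  by (simp add: upd_row_def)

lemma upd_row_self [simp]: "upd_row M i (M $ i) = M"
  by (simp add: vec_eq_iff upd_row_nth)

lemma det_upd_row_diff:
  fixes M :: "'a::comm_ring_1 ^ 'n ^ 'n"
  shows "det (upd_row M i (v - w)) = det (upd_row M i v) - det (upd_row M i w)"
proof -
  have "det (upd_row M i ((v - w) + w)) = det (upd_row M i (v - w)) + det (upd_row M i w)"
    unfolding upd_row_def by (rule det_row_add)
  then show ?thesis by simp
qed

lemma det_upd_row_expand:
  fixes M :: "'a::comm_ring_1 ^ 'n ^ 'n"
  shows "det (upd_row M i w) = (\<Sum>k\<in>UNIV. w $ k * det (upd_row M i (axis k 1)))"
proof -
  have "w = (\<Sum>k\<in>UNIV. w $ k *s axis k 1)"
    by (simp add: vec_eq_iff axis_def if_distrib[of "\<lambda>x. _ * x"] cong: if_cong)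
  then have "det (upd_row M i w) = det (upd_row M i (\<Sum>k\<in>UNIV. w $ k *s axis k 1))"
    by simp
  also have "\<dots> = (\<Sum>k\<in>UNIV. det (upd_row M i (w $ k *s axis k 1)))"
    unfolding upd_row_def by (rule det_linear_row_sum) simp
  also have "\<dots> = (\<Sum>k\<in>UNIV. w $ k * det (upd_row M i (axis k 1)))"
    unfolding upd_row_def by (simp add: det_row_mul)
  finally show ?thesis .
qed

lemma det_upd_row_other:
  fixes M :: "'a::comm_ring_1 ^ 'n ^ 'n"
  assumes "i \<noteq> j"
  shows "det (upd_row M i (M $ j)) = 0"
  by (rule det_identical_rows[OF assms]) (use assms in \<open>simp add: row_def upd_row_nth\<close>)

text \<open>
  Replacing row \<open>i\<close> by the unit vector \<open>e\<^sub>k\<close> gives the \<open>(i, k)\<close> cofactor, so this and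
  \<open>column_cofactor_expansion\<close> are the two halves of the adjugate identity. In this form
  cofactors of matrices that were already changed in one row need no minors.
\<close>

lemma row_cofactor_expansion:
  fixes M :: "'a::comm_ring_1 ^ 'n ^ 'n"
  shows "(\<Sum>k\<in>UNIV. M $ j $ k * det (upd_row M i (axis k 1))) = (if i = j then det M else 0)"
  using det_upd_row_expand[of M i "M $ j"] det_upd_row_other[of i j M] by auto

text \<open>
  Both sides are the \<open>(l, j)\<close> cofactor: in the permutation expansion of either one, only
  the terms with \<open>p l = j\<close> survive, and they agree.
\<close>

lemma det_upd_row_axis_transpose:
  fixes M :: "'a::comm_ring_1 ^ 'n ^ 'n"
  shows "det (upd_row M l (axis j 1)) = det (upd_row (transpose M) j (axis l 1))"
proof -
  have "det (upd_row M l (axis j 1)) = det (transpose (upd_row (transpose M) j (axis l 1)))"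
    unfolding det_def
  proof (rule sum.cong[OF refl])
    fix p assume p: "p \<in> {p. p permutes (UNIV :: 'n set)}"
    have "(\<Prod>i\<in>UNIV. upd_row M l (axis j 1) $ i $ p i) =
          (\<Prod>i\<in>UNIV. transpose (upd_row (transpose M) j (axis l 1)) $ i $ p i)"
    proof (cases "p l = j")
      case True
      with p have "p i = j \<longleftrightarrow> i = l" for i
        by (metis mem_Collect_eq permutes_inverses(2))
      with True show ?thesis
        by (intro prod.cong) (auto simp: upd_row_nth transpose_def axis_def)
    next
      case False
      from p have pi: "p (inv p j) = j" by (simp add: permutes_inverses)
      have "upd_row M l (axis j 1) $ l $ p l = 0"
        using False by (simp add: upd_row_nth axis_def)
      then have 1: "(\<Prod>i\<in>UNIV. upd_row M l (axis j 1) $ i $ p i) = 0"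
        by (intro prod_zero) auto
      have "transpose (upd_row (transpose M) j (axis l 1)) $ inv p j $ p (inv p j) = 0"
        using False pi by (auto simp: upd_row_nth transpose_def axis_def)
      then have "(\<Prod>i\<in>UNIV. transpose (upd_row (transpose M) j (axis l 1)) $ i $ p i) = 0"
        by (intro prod_zero) auto
      with 1 show ?thesis by simp
    qed
    then show "of_int (sign p) * (\<Prod>i\<in>UNIV. upd_row M l (axis j 1) $ i $ p i) =
      of_int (sign p) * (\<Prod>i\<in>UNIV. transpose (upd_row (transpose M) j (axis l 1)) $ i $ p i)"
      by simp
  qed
  then show ?thesis by simp
qed

lemma column_cofactor_expansion:
  fixes M :: "'a::comm_ring_1 ^ 'n ^ 'n"
  shows "(\<Sum>l\<in>UNIV. M $ l $ m * det (upd_row M l (axis j 1))) = (if m = j then det M else 0)"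
proof -
  have "(\<Sum>l\<in>UNIV. M $ l $ m * det (upd_row M l (axis j 1))) =
        (\<Sum>l\<in>UNIV. transpose M $ m $ l * det (upd_row (transpose M) j (axis l 1)))"
    unfolding det_upd_row_axis_transpose[of M] by (simp add: transpose_def)
  also have "\<dots> = (if j = m then det (transpose M) else 0)"
    by (rule row_cofactor_expansion)
  finally show ?thesis by auto
qed

text \<open>
  This is why a determinant with a Koszul row \<open>x\<^sub>j e\<^sub>k - x\<^sub>k e\<^sub>j\<close> in place of row \<open>i\<close> lies in the
  ideal of the entries of \<open>M x\<close> other than the \<open>i\<close>-th. It follows from the column expansions of
  \<open>M\<close> with row \<open>i\<close> replaced by \<open>e\<^sub>k\<close>: the term \<open>l = i\<close> of the expansion along column \<open>k\<close> is the
  cofactor that belongs to \<open>e\<^sub>j\<close>.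
\<close>

lemma cofactor_cross_relation:
  fixes M :: "'a::comm_ring_1 ^ 'n ^ 'n"
  shows "x j * det (upd_row M i (axis k 1)) - x k * det (upd_row M i (axis j 1)) =
    (\<Sum>l\<in>UNIV - {i}. (\<Sum>m\<in>UNIV. M $ l $ m * x m) *
        det (upd_row (upd_row M i (axis k 1)) l (axis j 1)))"
proof -
  let ?N = "upd_row M i (axis k 1)"
  have split: "(\<Sum>l\<in>UNIV. ?N $ l $ m * det (upd_row ?N l (axis j 1))) =
      (if m = k then det (upd_row M i (axis j 1)) else 0) +
      (\<Sum>l\<in>UNIV - {i}. M $ l $ m * det (upd_row ?N l (axis j 1)))" for m
  proof -
    have "upd_row ?N i (axis j 1) = upd_row M i (axis j 1)"
      by (simp add: vec_eq_iff upd_row_nth)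
    then show ?thesis
      by (subst sum.remove[of UNIV i]) (auto simp: upd_row_nth axis_def intro!: sum.cong)
  qed
  have "(\<Sum>l\<in>UNIV - {i}. (\<Sum>m\<in>UNIV. M $ l $ m * x m) * det (upd_row ?N l (axis j 1))) =
      (\<Sum>m\<in>UNIV. x m * (\<Sum>l\<in>UNIV - {i}. M $ l $ m * det (upd_row ?N l (axis j 1))))"
    unfolding sum_distrib_left sum_distrib_right
    by (subst sum.swap) (simp add: mult_ac)
  also have "\<dots> = (\<Sum>m\<in>UNIV. x m * ((if m = j then det ?N else 0) -
                      (if m = k then det (upd_row M i (axis j 1)) else 0)))"
  proof (intro sum.cong refl arg_cong2[where f="(*)"])
    fix m
    show "(\<Sum>l\<in>UNIV - {i}. M $ l $ m * det (upd_row ?N l (axis j 1))) =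
        (if m = j then det ?N else 0) - (if m = k then det (upd_row M i (axis j 1)) else 0)"
      using split[of m] column_cofactor_expansion[of ?N m j] by (simp add: algebra_simps)
  qed
  also have "\<dots> = x j * det ?N - x k * det (upd_row M i (axis j 1))"
    by (simp add: right_diff_distrib sum_subtractf if_distrib[of "\<lambda>y. _ * y"] cong: if_cong)
  finally show ?thesis by simp
qed

text \<open>
  Derived from multilinearity and the vanishing for equal rows, by expanding the zero
  determinant with \<open>a + b\<close> in both rows.
\<close>

lemma det_swap_rows:
  fixes M :: "'a::comm_ring_1 ^ 'n ^ 'n"
  assumes "i \<noteq> r"
  shows "det (upd_row (upd_row M i a) r b) = - det (upd_row (upd_row M i b) r a)"
proof -
  have add: "det (upd_row N s (v + w)) = det (upd_row N s v) + det (upd_row N s w)"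
    for N :: "'a ^ 'n ^ 'n" and s v w
    unfolding upd_row_def by (rule det_row_add)
  have comm: "upd_row (upd_row M i v) r w = upd_row (upd_row M r w) i v" for v w
    using assms by (simp add: vec_eq_iff upd_row_nth)
  have add_left: "det (upd_row (upd_row M i (v + v')) r w) =
      det (upd_row (upd_row M i v) r w) + det (upd_row (upd_row M i v') r w)" for v v' w
    unfolding comm by (rule add)
  have same: "det (upd_row (upd_row M i v) r v) = 0" for v
    by (rule det_identical_rows[OF assms]) (use assms in \<open>simp add: row_def upd_row_nth\<close>)
  have "0 = det (upd_row (upd_row M i (a + b)) r (a + b))" using same by simp
  also have "\<dots> = det (upd_row (upd_row M i a) r a) + det (upd_row (upd_row M i a) r b)
      + (det (upd_row (upd_row M i b) r a) + det (upd_row (upd_row M i b) r b))"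
    unfolding add add_left by (simp only: ac_simps)
  finally show ?thesis using same by (simp add: eq_neg_iff_add_eq_0 add.commute)
qed

lemma derivation_prod:
  fixes D :: "'a::comm_ring_1 \<Rightarrow> 'a"
  assumes mult: "\<And>a b. D (a * b) = D a * b + a * D b" and "D 1 = 0" and "finite S"
  shows "D (prod h S) = (\<Sum>r\<in>S. \<Prod>i\<in>S. if i = r then D (h i) else h i)"
  using \<open>finite S\<close>
proof induction
  case empty
  then show ?case using \<open>D 1 = 0\<close> by simp
next
  case (insert x S)
  have "(\<Prod>i\<in>S. if i = x then D (h i) else h i) = prod h S"
    using insert by (intro prod.cong) auto
  moreover have "(\<Sum>r\<in>S. (if x = r then D (h x) else h x) * (\<Prod>i\<in>S. if i = r then D (h i) else h i))
     = h x * (\<Sum>r\<in>S. \<Prod>i\<in>S. if i = r then D (h i) else h i)"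
    unfolding sum_distrib_left using insert by (intro sum.cong) auto
  ultimately show ?case using insert by (simp add: mult)
qed

lemma derivation_det:
  fixes D :: "'a::comm_ring_1 \<Rightarrow> 'a" and M :: "'a ^ 'n ^ 'n"
  assumes add: "\<And>a b. D (a + b) = D a + D b" and mult: "\<And>a b. D (a * b) = D a * b + a * D b"
  shows "D (det M) = (\<Sum>r\<in>UNIV. det (upd_row M r (\<chi> c. D (M $ r $ c))))"
proof -
  have D0: "D 0 = 0" using add[of 0 0] by simp
  have D1: "D 1 = 0" using mult[of 1 1] by simp
  have Dm: "D (- a) = - D a" for a using add[of a "- a"] D0 by (simp add: add_eq_0_iff2)
  have Dsum: "D (sum h S) = (\<Sum>s\<in>S. D (h s))" for h :: "('n \<Rightarrow> 'n) \<Rightarrow> 'a" and S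
    by (induction S rule: infinite_finite_induct) (auto simp: D0 add)
  have Dsign: "D (of_int (sign p) * a) = of_int (sign p) * D a" for p :: "'n \<Rightarrow> 'n" and a
    by (auto simp: sign_def Dm)
  show ?thesis
    unfolding det_def Dsum Dsign derivation_prod[of D, OF mult D1 finite]
    by (subst sum.swap, rule sum.cong[OF refl], subst sum_distrib_left[symmetric],
        intro arg_cong2[where f="(*)"] refl sum.cong prod.cong)
       (auto simp: upd_row_nth)
qed

section \<open>Polynomials: evaluation, derivatives, homogeneity\<close>

abbreviation const :: "complex \<Rightarrow> ('n::finite) cpoly" where
  "const c \<equiv> Poly_Mapping.single 0 c"

definition Var :: "'n \<Rightarrow> ('n::finite) cpoly" where
  "Var i = Poly_Mapping.single (Poly_Mapping.single i 1) 1"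

lemma poly_mapping_as_sum:
  "f = (\<Sum>m\<in>Poly_Mapping.keys f. Poly_Mapping.single m (Poly_Mapping.lookup f m))"
  by (rule poly_mapping_eqI) (auto simp: lookup_sum lookup_single when_def in_keys_iff)

lemma cpoly_single_induct [case_names single add]:
  fixes f :: "('n::finite) cpoly"
  assumes single: "\<And>m c. P (Poly_Mapping.single m c)"
    and add: "\<And>f g. P f \<Longrightarrow> P g \<Longrightarrow> P (f + g)"
  shows "P f"
proof -
  have "P (\<Sum>m\<in>S. Poly_Mapping.single m (Poly_Mapping.lookup f m))" if "finite S" for S
    using that
  proof induction
    case empty
    show ?case using single[of 0 0] by simp
  qed (simp add: single add)
  then show ?thesis
    using poly_mapping_as_sum[of f] by (metis finite_keys)
qed

lemma eval_single [simp]: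
  "eval_poly (Poly_Mapping.single m c) v = c * (\<Prod>i\<in>UNIV. (v $ i) ^ Poly_Mapping.lookup m i)"
  by (simp add: eval_poly_def)

lemma eval_add [simp]: "eval_poly (f + g) v = eval_poly f v + eval_poly g v"
  unfolding eval_poly_def
  by (rule setsum_keys_plus_distrib) (auto simp: algebra_simps)

lemma eval_mult [simp]: "eval_poly (f * g) v = eval_poly f v * eval_poly g v"
proof (induction f rule: cpoly_single_induct)
  case (single m c)
  then show ?case
    by (induction g rule: cpoly_single_induct)
       (simp_all add: mult_single lookup_add power_add prod.distrib distrib_left)
qed (simp add: distrib_right)

lemma eval_0 [simp]: "eval_poly 0 v = 0"
  by (simp add: eval_poly_def)

lemma eval_1 [simp]: "eval_poly 1 v = 1"
  using eval_single[of 0 1 v] by simp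

lemma eval_uminus [simp]: "eval_poly (- f) v = - eval_poly f v"
  using eval_add[of f "- f" v] by (simp add: add_eq_0_iff2)

lemma eval_sum [simp]: "eval_poly (sum h S) v = (\<Sum>s\<in>S. eval_poly (h s) v)"
  by (induction S rule: infinite_finite_induct) auto

lemma eval_prod [simp]: "eval_poly (prod h S) v = (\<Prod>s\<in>S. eval_poly (h s) v)"
  by (induction S rule: infinite_finite_induct) auto

lemma eval_det:
  fixes M :: "('n::finite) cpoly ^ 'k ^ 'k"
  shows "eval_poly (det M) v = det (\<chi> i j. eval_poly (M $ i $ j) v)"
proof -
  have "eval_poly (of_int (sign p)) v = of_int (sign p)" for p :: "'k \<Rightarrow> 'k"
    by (auto simp: sign_def)
  then show ?thesis unfolding det_def by simp
qed

lemma eval_Var [simp]: "eval_poly (Var i) v = v $ i"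
proof -
  have "(\<Prod>j\<in>UNIV. (v $ j) ^ Poly_Mapping.lookup (Poly_Mapping.single i 1) j) =
        (\<Prod>j\<in>UNIV. if j = i then v $ j else 1)"
    by (intro prod.cong) (auto simp: lookup_single when_def)
  then show ?thesis by (simp add: Var_def)
qed

lemma partial_single [simp]:
  "partial_deriv i (Poly_Mapping.single m c) =
     Poly_Mapping.single (m - Poly_Mapping.single i 1) (of_nat (Poly_Mapping.lookup m i) * c)"
  by (simp add: partial_deriv_def)

lemma partial_add [simp]: "partial_deriv i (f + g) = partial_deriv i f + partial_deriv i g"
  unfolding partial_deriv_def
  by (rule setsum_keys_plus_distrib) (auto simp: algebra_simps single_add)

lemma partial_0 [simp]: "partial_deriv i 0 = 0"
  by (simp add: partial_deriv_def)

lemma partial_sum [simp]: "partial_deriv i (sum h S) = (\<Sum>s\<in>S. partial_deriv i (h s))"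
  by (induction S rule: infinite_finite_induct) auto

lemma partial_mult:
  "partial_deriv i (f * g) = partial_deriv i f * g + f * partial_deriv i g"
proof (induction f rule: cpoly_single_induct)
  case (single m c)
  show ?case
  proof (induction g rule: cpoly_single_induct)
    case (single m' c')
    let ?s = "Poly_Mapping.single i (1::nat)"
    have 1: "(m - ?s) + m' = m + m' - ?s" if "Poly_Mapping.lookup m i \<noteq> 0"
      using that by (intro poly_mapping_eqI)
        (auto simp: lookup_add lookup_minus lookup_single when_def)
    have 2: "m + (m' - ?s) = m + m' - ?s" if "Poly_Mapping.lookup m' i \<noteq> 0"
      using that by (intro poly_mapping_eqI)
        (auto simp: lookup_add lookup_minus lookup_single when_def)
    show ?case
      using 1 2
      by (cases "Poly_Mapping.lookup m i = 0"; cases "Poly_Mapping.lookup m' i = 0")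
         (auto simp: mult_single lookup_add algebra_simps single_add[symmetric])
  qed (simp add: distrib_left)
qed (simp add: distrib_right)

lemma partial_commute: "partial_deriv i (partial_deriv j f) = partial_deriv j (partial_deriv i f)"
proof (induction f rule: cpoly_single_induct)
  case (single m c)
  have "m - Poly_Mapping.single j 1 - Poly_Mapping.single i 1 =
        m - Poly_Mapping.single i 1 - Poly_Mapping.single j (1::nat)"
    by (rule poly_mapping_eqI) (simp add: lookup_minus)
  then show ?case
    by (cases "i = j") (auto simp: lookup_minus lookup_single when_def mult_ac)
qed simp

lemma partial_Var [simp]: "partial_deriv i (Var j) = (if i = j then 1 else 0)"
  by (auto simp: Var_def lookup_single when_def)

lemma const_mult: "const (a * b) = const a * const b"
  by (simp add: mult_single)

lemma single_eq_prod_Var: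
  "Poly_Mapping.single m c = const c * (\<Prod>i\<in>UNIV. Var i ^ Poly_Mapping.lookup m i)"
  for m :: "('n::finite) \<Rightarrow>\<^sub>0 nat"
proof -
  have pow: "Var i ^ k = Poly_Mapping.single (Poly_Mapping.single i k) 1" for i :: 'n and k
    by (induction k) (simp_all add: Var_def mult_single single_add[symmetric])
  have prod: "(\<Prod>i\<in>S. Poly_Mapping.single (h i) (1::complex)) = Poly_Mapping.single (sum h S) 1"
    for h :: "'n \<Rightarrow> ('n \<Rightarrow>\<^sub>0 nat)" and S
    by (induction S rule: infinite_finite_induct) (auto simp: mult_single)
  have "(\<Sum>i\<in>UNIV. Poly_Mapping.single i (Poly_Mapping.lookup m i)) = m"
    by (rule poly_mapping_eqI) (simp add: lookup_sum lookup_single when_def)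
  then show ?thesis by (simp add: pow prod mult_single)
qed

text \<open>
  The rule for statements that are preserved by sums and products, such as the chain rule
  along lines.
\<close>

lemma cpoly_ring_induct [case_names const Var add mult]:
  fixes f :: "('n::finite) cpoly"
  assumes const: "\<And>c. P (const c)" and Var: "\<And>i. P (Var i)"
    and add: "\<And>f g. P f \<Longrightarrow> P g \<Longrightarrow> P (f + g)" and mult: "\<And>f g. P f \<Longrightarrow> P g \<Longrightarrow> P (f * g)"
  shows "P f"
proof (induction f rule: cpoly_single_induct)
  case (single m c)
  have one: "P 1" using const[of 1] by simp
  have pow: "P (Var i ^ k)" for i k
    by (induction k) (simp_all add: one Var mult)
  have "P (\<Prod>i\<in>S. Var i ^ Poly_Mapping.lookup m i)" for S
    by (induction S rule: infinite_finite_induct) (simp_all add: one pow mult)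
  then show ?case by (subst single_eq_prod_Var) (intro mult const)
qed (rule add)

lemma homogeneous_single: "(\<Sum>i\<in>UNIV. Poly_Mapping.lookup m i) = e \<Longrightarrow>
    homogeneous_poly e (Poly_Mapping.single m c)"
  by (auto simp: homogeneous_poly_def)

lemma homogeneous_0 [simp]: "homogeneous_poly e 0"
  by (simp add: homogeneous_poly_def)

lemma homogeneous_const [simp]: "homogeneous_poly 0 (const c)"
  by (rule homogeneous_single) simp

lemma homogeneous_Var [simp]: "homogeneous_poly (Suc 0) (Var i)"
  unfolding Var_def by (rule homogeneous_single) (simp add: lookup_single when_def)

lemma homogeneous_add:
  "homogeneous_poly e f \<Longrightarrow> homogeneous_poly e g \<Longrightarrow> homogeneous_poly e (f + g)"
  using keys_add[of f g] by (auto simp: homogeneous_poly_def)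

lemma homogeneous_mult:
  "homogeneous_poly a f \<Longrightarrow> homogeneous_poly b g \<Longrightarrow> homogeneous_poly (a + b) (f * g)"
  using keys_mult[of f g] by (fastforce simp: homogeneous_poly_def lookup_add sum.distrib)

lemma homogeneous_const_mult: "homogeneous_poly e f \<Longrightarrow> homogeneous_poly e (const c * f)"
  using homogeneous_mult[OF homogeneous_const[of c]] by fastforce

lemma homogeneous_diff:
  "homogeneous_poly e f \<Longrightarrow> homogeneous_poly e g \<Longrightarrow> homogeneous_poly e (f - g)"
  using keys_diff[of f g] by (auto simp: homogeneous_poly_def)

lemma homogeneous_sum:
  "(\<And>s. s \<in> S \<Longrightarrow> homogeneous_poly e (h s)) \<Longrightarrow> homogeneous_poly e (sum h S)"
  by (induction S rule: infinite_finite_induct) (auto intro: homogeneous_add)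

lemma homogeneous_power: "homogeneous_poly a f \<Longrightarrow> homogeneous_poly (k * a) (f ^ k)"
  using homogeneous_const[of 1] by (induction k) (auto dest: homogeneous_mult)

lemma homogeneous_partial:
  assumes "homogeneous_poly (Suc e) f"
  shows "homogeneous_poly e (partial_deriv i f)"
  unfolding partial_deriv_def
proof (rule homogeneous_sum)
  fix m assume "m \<in> Poly_Mapping.keys f"
  with assms have deg: "(\<Sum>j\<in>UNIV. Poly_Mapping.lookup m j) = Suc e"
    by (simp add: homogeneous_poly_def)
  show "homogeneous_poly e (Poly_Mapping.single (m - Poly_Mapping.single i 1)
          (of_nat (Poly_Mapping.lookup m i) * Poly_Mapping.lookup f m))"
  proof (cases "Poly_Mapping.lookup m i = 0")
    case False
    have "(\<Sum>j\<in>UNIV. Poly_Mapping.lookup (m - Poly_Mapping.single i 1) j) =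
          (\<Sum>j\<in>UNIV. Poly_Mapping.lookup m j) - 1"
      using False
      by (simp add: sum.remove[of UNIV i] lookup_minus lookup_single when_def)
    with deg show ?thesis by (intro homogeneous_single) simp
  qed simp
qed

lemma euler_identity:
  assumes "homogeneous_poly e f"
  shows "(\<Sum>j\<in>UNIV. Var j * partial_deriv j f) = const (of_nat e) * f"
proof -
  have mono: "(\<Sum>j\<in>UNIV. Var j * partial_deriv j (Poly_Mapping.single m c)) =
        const (of_nat (\<Sum>j\<in>UNIV. Poly_Mapping.lookup m j)) * Poly_Mapping.single m c"
    for m :: "'a \<Rightarrow>\<^sub>0 nat" and c
  proof -
    have "Var j * partial_deriv j (Poly_Mapping.single m c) =
          Poly_Mapping.single m (of_nat (Poly_Mapping.lookup m j) * c)" for j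
    proof (cases "Poly_Mapping.lookup m j = 0")
      case False
      then have "Poly_Mapping.single j 1 + (m - Poly_Mapping.single j 1) = m"
        by (intro poly_mapping_eqI) (auto simp: lookup_add lookup_minus lookup_single when_def)
      then show ?thesis by (simp add: Var_def mult_single)
    qed simp
    moreover have "(\<Sum>j\<in>S. Poly_Mapping.single m (of_nat (Poly_Mapping.lookup m j) * c)) =
       Poly_Mapping.single m (of_nat (\<Sum>j\<in>S. Poly_Mapping.lookup m j) * c)" for S
      by (induction S rule: infinite_finite_induct) (auto simp: single_add[symmetric] algebra_simps)
    ultimately show ?thesis by (simp add: mult_single)
  qed
  let ?t = "\<lambda>m. Poly_Mapping.single m (Poly_Mapping.lookup f m)"
  have "(\<Sum>j\<in>UNIV. Var j * partial_deriv j f) =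
        (\<Sum>j\<in>UNIV. Var j * partial_deriv j (\<Sum>m\<in>Poly_Mapping.keys f. ?t m))"
    by (simp only: poly_mapping_as_sum[symmetric])
  also have "\<dots> = (\<Sum>m\<in>Poly_Mapping.keys f. \<Sum>j\<in>UNIV. Var j * partial_deriv j (?t m))"
    unfolding partial_sum sum_distrib_left by (rule sum.swap)
  also have "\<dots> = (\<Sum>m\<in>Poly_Mapping.keys f. const (of_nat e) * ?t m)"
    unfolding mono using assms by (intro sum.cong) (simp_all add: homogeneous_poly_def)
  also have "\<dots> = const (of_nat e) * f"
    unfolding sum_distrib_left[symmetric] by (simp only: poly_mapping_as_sum[symmetric])
  finally show ?thesis .
qed

lemma eval_homogeneous_scale:
  assumes "homogeneous_poly e f"
  shows "eval_poly f (c *s v) = c ^ e * eval_poly f v"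
proof -
  have "(\<Prod>i\<in>UNIV. c ^ Poly_Mapping.lookup m i) = c ^ e" if "m \<in> Poly_Mapping.keys f" for m
    using assms that by (simp add: homogeneous_poly_def power_sum[symmetric])
  then show ?thesis
    unfolding eval_poly_def sum_distrib_left
    by (intro sum.cong) (simp_all add: power_mult_distrib prod.distrib)
qed

section \<open>Transition matrices and singular points\<close>

definition ideal_of :: "('n::finite \<Rightarrow> 'n cpoly) \<Rightarrow> 'n cpoly set" where
  "ideal_of F = {(\<Sum>i\<in>UNIV. g i * F i) | g. True}"

lemma ideal_of_add: "a \<in> ideal_of F \<Longrightarrow> b \<in> ideal_of F \<Longrightarrow> a + b \<in> ideal_of F"
proof -
  assume "a \<in> ideal_of F" "b \<in> ideal_of F"
  then obtain g h where "a = (\<Sum>i\<in>UNIV. g i * F i)" "b = (\<Sum>i\<in>UNIV. h i * F i)"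
    by (auto simp: ideal_of_def)
  then have "a + b = (\<Sum>i\<in>UNIV. (g i + h i) * F i)"
    by (simp add: sum.distrib distrib_right)
  then show ?thesis unfolding ideal_of_def mem_Collect_eq by (intro exI[of _ "\<lambda>i. g i + h i"]) simp
qed

lemma ideal_of_mult: "a \<in> ideal_of F \<Longrightarrow> p * a \<in> ideal_of F"
proof -
  assume "a \<in> ideal_of F"
  then obtain g where "a = (\<Sum>i\<in>UNIV. g i * F i)"
    by (auto simp: ideal_of_def)
  then have "p * a = (\<Sum>i\<in>UNIV. (p * g i) * F i)"
    by (simp add: sum_distrib_left mult.assoc)
  then show ?thesis unfolding ideal_of_def mem_Collect_eq by (intro exI[of _ "\<lambda>i. p * g i"]) simp
qed

lemma ideal_of_0: "0 \<in> ideal_of F"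
  unfolding ideal_of_def by (auto intro!: exI[of _ "\<lambda>_. 0"])

lemma ideal_of_gen: "F i \<in> ideal_of F"
proof -
  have "F i = (\<Sum>j\<in>UNIV. (if j = i then 1 else 0) * F j)"
    by (simp add: if_distrib[of "\<lambda>x. x * _"] cong: if_cong)
  then show ?thesis unfolding ideal_of_def mem_Collect_eq
    by (intro exI[of _ "\<lambda>j. if j = i then 1 else 0"]) simp
qed

lemma ideal_of_sum: "(\<And>s. s \<in> S \<Longrightarrow> h s \<in> ideal_of F) \<Longrightarrow> sum h S \<in> ideal_of F"
  by (induction S rule: infinite_finite_induct) (auto simp: ideal_of_0 ideal_of_add)

text \<open>
  Exactness of the Koszul complex of the variables at the linear syzygies, with an explicit
  antisymmetric matrix of coefficients that characteristic zero provides: differentiate the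
  syzygy by \<open>x\<^sub>k\<close> and use Euler's identity for \<open>r k\<close>.
\<close>

lemma linear_syzygy_koszul:
  fixes r :: "'n::finite \<Rightarrow> 'n cpoly"
  assumes "\<And>j. homogeneous_poly e (r j)" and syz: "(\<Sum>j\<in>UNIV. r j * Var j) = 0"
  shows "const (of_nat (Suc e)) * r k =
    (\<Sum>j\<in>UNIV. Var j * (partial_deriv j (r k) - partial_deriv k (r j)))"
proof -
  have "0 = partial_deriv k (\<Sum>j\<in>UNIV. r j * Var j)"
    using syz by simp
  also have "\<dots> = (\<Sum>j\<in>UNIV. Var j * partial_deriv k (r j)) + r k"
    by (simp add: partial_mult sum.distrib mult.commute[of _ "Var _"]
        if_distrib[of "\<lambda>x. x * _"] cong: if_cong)
  finally have "(\<Sum>j\<in>UNIV. Var j * partial_deriv k (r j)) = - r k"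
    by (simp add: eq_neg_iff_add_eq_0)
  moreover have "(\<Sum>j\<in>UNIV. Var j * partial_deriv j (r k)) = const (of_nat e) * r k"
    using assms(1) by (rule euler_identity)
  moreover have "const (of_nat (Suc e)) = 1 + (const (of_nat e) :: 'n cpoly)"
    by (simp add: single_add)
  ultimately show ?thesis
    by (simp add: right_diff_distrib sum_subtractf distrib_right)
qed

text \<open>
  The Koszul coefficients \<open>c j k\<close> are antisymmetric, so twice the determinant is a
  combination of the cross differences \<open>x\<^sub>j C\<^sub>k - x\<^sub>k C\<^sub>j\<close> of cofactors, which
  \<open>cofactor_cross_relation\<close> puts into the ideal.
\<close>

lemma det_syzygy_row_in_ideal:
  fixes M :: "('n::finite) cpoly ^ 'n ^ 'n"
  assumes hom: "\<And>j. homogeneous_poly e (r $ j)" and syz: "(\<Sum>j\<in>UNIV. r $ j * Var j) = 0"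
    and M: "\<And>l. (\<Sum>m\<in>UNIV. M $ l $ m * Var m) \<in> ideal_of F"
  shows "det (upd_row M i r) \<in> ideal_of F"
proof -
  define C where "C k = det (upd_row M i (axis k 1))" for k
  define c where "c j k = partial_deriv j (r $ k) - partial_deriv k (r $ j)" for j k
  let ?d = "const (of_nat (Suc e)) * det (upd_row M i r)"
  have "?d = (\<Sum>k\<in>UNIV. const (of_nat (Suc e)) * r $ k * C k)"
    unfolding det_upd_row_expand[of M i r] C_def sum_distrib_left by (simp only: mult.assoc)
  also have "\<dots> = (\<Sum>k\<in>UNIV. \<Sum>j\<in>UNIV. c j k * (Var j * C k))"
    unfolding linear_syzygy_koszul[of e "($) r", OF hom syz] sum_distrib_right c_def
    by (simp only: mult_ac)
  finally have 1: "?d = (\<Sum>k\<in>UNIV. \<Sum>j\<in>UNIV. c j k * (Var j * C k))" .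
  also have "\<dots> = (\<Sum>k\<in>UNIV. \<Sum>j\<in>UNIV. c k j * (Var k * C j))"
    by (rule sum.swap)
  also have "\<dots> = (\<Sum>k\<in>UNIV. \<Sum>j\<in>UNIV. - (c j k * (Var k * C j)))"
    by (intro sum.cong) (simp_all add: c_def algebra_simps)
  finally have 2: "?d = \<dots>" .
  have "?d + ?d = (\<Sum>k\<in>UNIV. \<Sum>j\<in>UNIV. c j k * (Var j * C k - Var k * C j))"
    by (subst (1) 1, subst 2) (simp add: sum.distrib[symmetric] right_diff_distrib)
  also have "\<dots> \<in> ideal_of F"
  proof (intro ideal_of_sum ideal_of_mult)
    fix j k
    show "Var j * C k - Var k * C j \<in> ideal_of F"
      unfolding C_def cofactor_cross_relation mult.commute[of "sum _ _"]
      by (intro ideal_of_sum ideal_of_mult M)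
  qed
  finally have "const (1 / (2 * of_nat (Suc e))) * (?d + ?d) \<in> ideal_of F"
    by (rule ideal_of_mult)
  also have "const (1 / (2 * of_nat (Suc e))) * (?d + ?d) = det (upd_row M i r)"
  proof -
    have "?d + ?d = const (2 * of_nat (Suc e)) * det (upd_row M i r)"
      by (simp only: mult_2 single_add distrib_right)
    moreover have "const (1 / (2 * of_nat (Suc e))) * const (2 * of_nat (Suc e)) = (1 :: 'n cpoly)"
      by (simp add: mult_single del: of_nat_Suc)
    ultimately show ?thesis
      by (simp only: mult.assoc[symmetric] mult_1_left)
  qed
  finally show ?thesis .
qed

text \<open>
  The rows of \<open>B\<close> are exchanged for those of \<open>H\<close> one at a time. Each exchange changes the
  determinant by one whose new row is a linear syzygy of the variables.
\<close>

lemma det_transition_matrix_unique: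
  fixes H B :: "('n::finite) cpoly ^ 'n ^ 'n"
  assumes homH: "\<And>i j. homogeneous_poly e (H $ i $ j)"
    and homB: "\<And>i j. homogeneous_poly e (B $ i $ j)"
    and eq: "\<And>i. (\<Sum>j\<in>UNIV. H $ i $ j * Var j) = (\<Sum>j\<in>UNIV. B $ i $ j * Var j)"
    and I: "\<And>i. (\<Sum>j\<in>UNIV. B $ i $ j * Var j) \<in> ideal_of F"
    and B: "det B \<in> ideal_of F"
  shows "det H \<in> ideal_of F"
proof -
  define M where "M S = (\<chi> r. if r \<in> S then H $ r else B $ r)" for S
  have "det (M S) \<in> ideal_of F" if "finite S" for S
    using that
  proof induction
    case empty
    have "M {} = B" by (simp add: M_def vec_eq_iff)
    with B show ?case by simp
  next
    case (insert i S)
    have rows: "M (insert i S) = upd_row (M S) i (H $ i)" "M S = upd_row (M S) i (B $ i)"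
      using insert by (auto simp: M_def vec_eq_iff upd_row_nth)
    have "det (upd_row (M S) i (H $ i - B $ i)) \<in> ideal_of F"
    proof (rule det_syzygy_row_in_ideal)
      show "homogeneous_poly e ((H $ i - B $ i) $ j)" for j
        using homH homB by (simp add: homogeneous_diff)
      show "(\<Sum>j\<in>UNIV. (H $ i - B $ i) $ j * Var j) = 0"
        using eq[of i] by (simp add: left_diff_distrib sum_subtractf)
      show "(\<Sum>m\<in>UNIV. M S $ l $ m * Var m) \<in> ideal_of F" for l
        using I[of l] eq[of l] by (simp add: M_def)
    qed
    moreover have "det (M (insert i S)) = det (upd_row (M S) i (H $ i - B $ i)) + det (M S)"
      unfolding det_upd_row_diff rows(1) rows(2)[symmetric] by simp
    ultimately show ?case
      using insert by (simp add: ideal_of_add)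
  qed
  from this[of UNIV] show ?thesis by (simp add: M_def)
qed

text \<open>
  Modulo the linear forms \<open>x\<^sub>j - w\<^sub>j x\<^sub>k\<close>, each \<open>x\<^sub>j\<close> is congruent to \<open>w\<^sub>j x\<^sub>k\<close>, hence a monomial of
  degree \<open>e + 1\<close> to its value at \<open>w\<close> times \<open>x\<^sub>k\<^sup>e\<^sup>+\<^sup>1\<close>. The induction on the degree keeps track of
  the homogeneity of the coefficients, which the Koszul argument needs.
\<close>

lemma monomial_mod_point:
  fixes w :: "complex ^ 'n::finite"
  assumes "(\<Sum>i\<in>UNIV. Poly_Mapping.lookup m i) = Suc e"
  shows "\<exists>c. (\<forall>j. homogeneous_poly e (c j)) \<and>
     Poly_Mapping.single m 1 - const (\<Prod>i\<in>UNIV. (w $ i) ^ Poly_Mapping.lookup m i) * Var k ^ Suc e =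
     (\<Sum>j\<in>UNIV. c j * (Var j - const (w $ j) * Var k))"
  using assms
proof (induction e arbitrary: m)
  case 0
  then obtain i where "Poly_Mapping.lookup m i \<noteq> 0" by (metis sum.neutral One_nat_def zero_neq_one)
  then have "Poly_Mapping.lookup m i = 1 \<and> (\<forall>j. j \<noteq> i \<longrightarrow> Poly_Mapping.lookup m j = 0)"
    using 0 by (auto simp: sum.remove[of UNIV i] sum_eq_0_iff add_is_1)
  then have m: "m = Poly_Mapping.single i 1"
    by (intro poly_mapping_eqI) (auto simp: lookup_single when_def)
  have "Poly_Mapping.single m 1 - const (\<Prod>i\<in>UNIV. (w $ i) ^ Poly_Mapping.lookup m i) * Var k ^ Suc 0
     = Var i - const (w $ i) * Var k"
    using eval_Var[of i w] unfolding m Var_def eval_single by simp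
  also have "\<dots> = (\<Sum>j\<in>UNIV. (if j = i then 1 else 0) * (Var j - const (w $ j) * Var k))"
    by (simp add: if_distrib[of "\<lambda>x. x * _"] cong: if_cong)
  finally show ?case
    using homogeneous_const[of 1] by (intro exI[of _ "\<lambda>j. if j = i then 1 else 0"]) auto
next
  case (Suc e)
  then obtain i where i: "Poly_Mapping.lookup m i \<noteq> 0" by (metis sum.neutral nat.distinct(1))
  define m' where "m' = m - Poly_Mapping.single i 1"
  have m: "m = Poly_Mapping.single i 1 + m'"
    using i unfolding m'_def
    by (intro poly_mapping_eqI) (auto simp: lookup_add lookup_minus lookup_single when_def)
  have "(\<Sum>j\<in>UNIV. Poly_Mapping.lookup m' j) = Suc e"
    using Suc.prems unfolding m by (simp add: lookup_add sum.distrib lookup_single when_def)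
  from Suc.IH[OF this] obtain c where c: "\<And>j. homogeneous_poly e (c j)"
    "Poly_Mapping.single m' 1 - const (eval_poly (Poly_Mapping.single m' 1) w) * Var k ^ Suc e =
     (\<Sum>j\<in>UNIV. c j * (Var j - const (w $ j) * Var k))" by auto
  let ?a = "eval_poly (Poly_Mapping.single m' 1) w"
  define c' where "c' j = Var i * c j + (if j = i then const ?a * Var k ^ Suc e else 0)" for j
  have sm: "Poly_Mapping.single m 1 = Var i * (Poly_Mapping.single m' 1 :: 'n cpoly)"
    unfolding m by (simp add: Var_def mult_single)
  have ev: "(\<Prod>i\<in>UNIV. (w $ i) ^ Poly_Mapping.lookup m i) = w $ i * ?a"
  proof -
    have "eval_poly (Poly_Mapping.single m 1) w = w $ i * ?a"
      unfolding sm eval_mult eval_Var ..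
    then show ?thesis by simp
  qed
  have "(\<Sum>j\<in>UNIV. c' j * (Var j - const (w $ j) * Var k)) =
      Var i * (\<Sum>j\<in>UNIV. c j * (Var j - const (w $ j) * Var k)) +
      const ?a * Var k ^ Suc e * (Var i - const (w $ i) * Var k)"
    by (simp add: c'_def distrib_right sum.distrib sum_distrib_left mult.assoc
        if_distrib[of "\<lambda>x. x * _"] cong: if_cong)
  also have "\<dots> = Var i * Poly_Mapping.single m' 1 - const (w $ i) * const ?a * Var k ^ Suc (Suc e)"
    unfolding c(2)[symmetric] by (simp only: power_Suc algebra_simps)
  finally have "Poly_Mapping.single m 1 -
      const (\<Prod>i\<in>UNIV. (w $ i) ^ Poly_Mapping.lookup m i) * Var k ^ Suc (Suc e) =
     (\<Sum>j\<in>UNIV. c' j * (Var j - const (w $ j) * Var k))"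
    unfolding sm ev const_mult by simp
  moreover have "homogeneous_poly (Suc e) (c' j)" for j
    using homogeneous_mult[OF homogeneous_Var c(1)] homogeneous_power[OF homogeneous_Var, of "Suc e" k]
    unfolding c'_def by (auto intro!: homogeneous_add homogeneous_const_mult simp del: power_Suc)
  ultimately show ?case by blast
qed

text \<open>
  For \<open>w\<^sub>k = 1\<close> the linear forms \<open>x\<^sub>j - w\<^sub>j x\<^sub>k\<close> generate the ideal of the line through \<open>w\<close>, which
  contains \<open>p\<close>. Each of them vanishes at \<open>w\<close>, and so does every row of coefficients that comes
  from a combination of them.
\<close>

lemma vanishing_at_point_transition:
  fixes w :: "complex ^ 'n::finite"
  assumes hom: "homogeneous_poly (Suc e) p" and van: "eval_poly p w = 0" and w: "w $ k = 1"
  shows "\<exists>b. (\<forall>j. homogeneous_poly e (b j)) \<and> (\<Sum>j\<in>UNIV. b j * Var j) = p \<and>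
     (\<Sum>j\<in>UNIV. b j * const (w $ j)) = 0"
proof -
  let ?c = "\<lambda>m. Poly_Mapping.lookup p m"
  have "\<forall>m\<in>Poly_Mapping.keys p. \<exists>c. (\<forall>j. homogeneous_poly e (c j)) \<and>
     Poly_Mapping.single m 1 - const (\<Prod>i\<in>UNIV. (w $ i) ^ Poly_Mapping.lookup m i) * Var k ^ Suc e =
     (\<Sum>j\<in>UNIV. c j * (Var j - const (w $ j) * Var k))"
    using hom monomial_mod_point unfolding homogeneous_poly_def by blast
  then obtain c where c: "\<And>m j. m \<in> Poly_Mapping.keys p \<Longrightarrow> homogeneous_poly e (c m j)"
    "\<And>m. m \<in> Poly_Mapping.keys p \<Longrightarrow> Poly_Mapping.single m 1 -
        const (\<Prod>i\<in>UNIV. (w $ i) ^ Poly_Mapping.lookup m i) * Var k ^ Suc e =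
     (\<Sum>j\<in>UNIV. c m j * (Var j - const (w $ j) * Var k))"
    unfolding bchoice_iff by blast
  define a where "a j = (\<Sum>m\<in>Poly_Mapping.keys p. const (?c m) * c m j)" for j
  \<comment> \<open>Collects the coefficients of the variables in the combination of the linear forms.\<close>
  define b where "b j = a j - (if j = k then \<Sum>l\<in>UNIV. const (w $ l) * a l else 0)" for j
  have homa: "homogeneous_poly e (a j)" for j
    unfolding a_def by (intro homogeneous_sum homogeneous_const_mult c)
  have homb: "homogeneous_poly e (b j)" for j
    unfolding b_def by (auto intro!: homogeneous_diff homa homogeneous_sum homogeneous_const_mult)
  have const_sum: "const (sum h S) = (\<Sum>s\<in>S. (const (h s) :: 'n cpoly))"
    for h :: "('n \<Rightarrow>\<^sub>0 nat) \<Rightarrow> complex" and S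
    by (induction S rule: infinite_finite_induct) (auto simp: single_add)
  have "(\<Sum>j\<in>UNIV. a j * (Var j - const (w $ j) * Var k)) =
      (\<Sum>m\<in>Poly_Mapping.keys p. const (?c m) * (\<Sum>j\<in>UNIV. c m j * (Var j - const (w $ j) * Var k)))"
    unfolding a_def sum_distrib_right sum_distrib_left mult.assoc by (rule sum.swap)
  also have "\<dots> = (\<Sum>m\<in>Poly_Mapping.keys p. const (?c m) * (Poly_Mapping.single m 1 -
        const (\<Prod>i\<in>UNIV. (w $ i) ^ Poly_Mapping.lookup m i) * Var k ^ Suc e))"
    using c(2) by simp
  also have "\<dots> = (\<Sum>m\<in>Poly_Mapping.keys p. Poly_Mapping.single m (?c m)) -
      const (eval_poly p w) * Var k ^ Suc e"
    unfolding eval_poly_def const_sum const_mult sum_distrib_right right_diff_distrib sum_subtractf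
    by (simp add: mult_single mult.assoc[symmetric])
  also have "\<dots> = p"
    using van by (simp add: poly_mapping_as_sum[symmetric])
  finally have a: "(\<Sum>j\<in>UNIV. a j * (Var j - const (w $ j) * Var k)) = p" .
  have "(\<Sum>j\<in>UNIV. b j * Var j) = (\<Sum>j\<in>UNIV. a j * Var j) - (\<Sum>l\<in>UNIV. const (w $ l) * a l) * Var k"
    by (simp add: b_def left_diff_distrib sum_subtractf if_distrib[of "\<lambda>x. x * _"] cong: if_cong)
  also have "\<dots> = p"
    unfolding a[symmetric] right_diff_distrib sum_subtractf sum_distrib_right by (simp only: mult_ac)
  finally have "(\<Sum>j\<in>UNIV. b j * Var j) = p" .
  moreover have "(\<Sum>j\<in>UNIV. b j * const (w $ j)) =
      (\<Sum>j\<in>UNIV. a j * const (w $ j)) - (\<Sum>l\<in>UNIV. const (w $ l) * a l) * const (w $ k)"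
    by (simp add: b_def left_diff_distrib sum_subtractf if_distrib[of "\<lambda>x. x * _"] cong: if_cong)
  then have "(\<Sum>j\<in>UNIV. b j * const (w $ j)) = 0"
    using w by (simp add: mult.commute)
  ultimately show ?thesis using homb by blast
qed

lemma hessian_row:
  assumes "homogeneous_poly (Suc (Suc e)) f"
  shows "(\<Sum>j\<in>UNIV. partial_deriv i (partial_deriv j f) * Var j) =
     const (of_nat (Suc e)) * partial_deriv i f"
  using euler_identity[OF homogeneous_partial[OF assms], of i]
  by (simp add: partial_commute[of i] mult.commute)

lemma hessian_in_jacobian_of_singular:
  fixes f :: "('n::finite) cpoly"
  assumes hom: "homogeneous_poly (Suc (Suc e)) f"
    and v: "v \<noteq> 0" and crit: "\<And>i. eval_poly (partial_deriv i f) v = 0"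
  shows "hessian_poly f \<in> jacobian_ideal f"
proof -
  from v obtain k where k: "v $ k \<noteq> 0" by (auto simp: vec_eq_iff)
  \<comment> \<open>The coordinate vector of the same point with \<open>k\<close>-th coordinate one.\<close>
  define w where "w = inverse (v $ k) *s v"
  have w: "w $ k = 1" using k by (simp add: w_def)
  let ?p = "\<lambda>i. const (of_nat (Suc e)) * partial_deriv i f"
  have homp: "homogeneous_poly (Suc e) (?p i)" for i
    using hom by (intro homogeneous_const_mult homogeneous_partial)
  have "eval_poly (?p i) w = 0" for i
    using crit[of i] by (simp add: w_def eval_homogeneous_scale[OF homogeneous_partial[OF hom]] del: of_nat_Suc)
  then have "\<forall>i. \<exists>b. (\<forall>j. homogeneous_poly e (b j)) \<and> (\<Sum>j\<in>UNIV. b j * Var j) = ?p i \<and>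
     (\<Sum>j\<in>UNIV. b j * const (w $ j)) = 0"
    using vanishing_at_point_transition[OF homp _ w] by blast
  then obtain b where b: "\<And>i j. homogeneous_poly e (b i j)"
    "\<And>i. (\<Sum>j\<in>UNIV. b i j * Var j) = ?p i" "\<And>i. (\<Sum>j\<in>UNIV. b i j * const (w $ j)) = 0"
    unfolding choice_iff by blast
  define B where "B = (\<chi> i j. b i j)"
  \<comment> \<open>Cramer's rule for \<open>B w = 0\<close> in coordinate \<open>k\<close>, where \<open>w\<close> has the entry one.\<close>
  have "det B = (\<Sum>m\<in>UNIV. const (w $ m) * (if m = k then det B else 0))"
    using w by (simp add: if_distrib[of "\<lambda>x. _ * x"] cong: if_cong)
  also have "\<dots> = (\<Sum>m\<in>UNIV. \<Sum>l\<in>UNIV. B $ l $ m * const (w $ m) * det (upd_row B l (axis k 1)))"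
    unfolding column_cofactor_expansion[symmetric] sum_distrib_left by (simp only: mult_ac)
  also have "\<dots> = (\<Sum>l\<in>UNIV. (\<Sum>m\<in>UNIV. B $ l $ m * const (w $ m)) * det (upd_row B l (axis k 1)))"
    unfolding sum_distrib_right by (rule sum.swap)
  also have "\<dots> = 0"
    by (simp add: B_def b(3))
  finally have detB: "det B = 0" .
  have "det (\<chi> i j. partial_deriv i (partial_deriv j f)) \<in> ideal_of (\<lambda>i. partial_deriv i f)"
  proof (rule det_transition_matrix_unique[where B = B])
    show "homogeneous_poly e ((\<chi> i j. partial_deriv i (partial_deriv j f)) $ i $ j)" for i j
      using hom by (simp add: homogeneous_partial)
    show "homogeneous_poly e (B $ i $ j)" for i j by (simp add: B_def b)
    show "(\<Sum>j\<in>UNIV. (\<chi> i j. partial_deriv i (partial_deriv j f)) $ i $ j * Var j) =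
          (\<Sum>j\<in>UNIV. B $ i $ j * Var j)" for i
      using hessian_row[OF hom, of i] by (simp add: B_def b(2))
    show "(\<Sum>j\<in>UNIV. B $ i $ j * Var j) \<in> ideal_of (\<lambda>i. partial_deriv i f)" for i
      using ideal_of_mult[OF ideal_of_gen[of "\<lambda>i. partial_deriv i f" i]]
      by (simp add: B_def b(2))
    show "det B \<in> ideal_of (\<lambda>i. partial_deriv i f)" by (simp add: detB ideal_of_0)
  qed
  then show ?thesis
    by (simp add: hessian_poly_def jacobian_ideal_def ideal_of_def)
qed

section \<open>Divergence-free cofactors and derivatives along lines\<close>

lemma partial_const [simp]: "partial_deriv i (const c) = 0"
  by simp

lemma cpoly_eq_uminus_self: "f = - f \<Longrightarrow> f = 0" for f :: "('n::finite) cpoly"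
proof (rule poly_mapping_eqI)
  fix m assume "f = - f"
  then have "Poly_Mapping.lookup f m = - Poly_Mapping.lookup f m"
    by (metis lookup_uminus)
  then show "Poly_Mapping.lookup f m = Poly_Mapping.lookup 0 m" by simp
qed

definition jacobian_matrix :: "('n::finite \<Rightarrow> 'n cpoly) \<Rightarrow> 'n cpoly ^ 'n ^ 'n" where
  "jacobian_matrix F = (\<chi> i j. partial_deriv j (F i))"

text \<open>
  The Piola identity. By the Leibniz rule the divergence is a sum over rows \<open>r \<noteq> i\<close> and over
  pairs \<open>(k, l)\<close> of the second derivatives of \<open>F r\<close>, which are symmetric in \<open>k\<close> and \<open>l\<close>, times
  determinants with the rows \<open>e\<^sub>k\<close> and \<open>e\<^sub>l\<close>, which are antisymmetric.
\<close>

lemma jacobian_cofactor_divergence_free: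
  fixes F :: "'n::finite \<Rightarrow> 'n cpoly"
  shows "(\<Sum>k\<in>UNIV. partial_deriv k (det (upd_row (jacobian_matrix F) i (axis k 1)))) = 0"
proof -
  let ?M = "jacobian_matrix F"
  have step: "partial_deriv k (det (upd_row ?M i (axis k 1))) =
      (\<Sum>r\<in>UNIV - {i}. \<Sum>l\<in>UNIV. partial_deriv k (partial_deriv l (F r)) *
          det (upd_row (upd_row ?M i (axis k 1)) r (axis l 1)))" for k
  proof -
    have "partial_deriv k (det (upd_row ?M i (axis k 1))) =
      (\<Sum>r\<in>UNIV. det (upd_row (upd_row ?M i (axis k 1)) r
                    (\<chi> c. partial_deriv k (upd_row ?M i (axis k 1) $ r $ c))))"
      by (rule derivation_det) (simp_all add: partial_mult)
    also have "\<dots> = (\<Sum>r\<in>UNIV. if r = i then 0 else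
        (\<Sum>l\<in>UNIV. partial_deriv k (partial_deriv l (F r)) *
          det (upd_row (upd_row ?M i (axis k 1)) r (axis l 1))))"
    proof (rule sum.cong[OF refl])
      fix r
      have "partial_deriv k (axis k 1 $ c) = (0 :: 'n cpoly)" for c
        using partial_const[of k 1] by (simp add: axis_def)
      then show "det (upd_row (upd_row ?M i (axis k 1)) r
                    (\<chi> c. partial_deriv k (upd_row ?M i (axis k 1) $ r $ c))) =
        (if r = i then 0 else
        (\<Sum>l\<in>UNIV. partial_deriv k (partial_deriv l (F r)) *
          det (upd_row (upd_row ?M i (axis k 1)) r (axis l 1))))"
        by (subst det_upd_row_expand) (simp add: upd_row_nth jacobian_matrix_def)
    qed
    also have "\<dots> = (\<Sum>r\<in>UNIV - {i}. \<Sum>l\<in>UNIV. partial_deriv k (partial_deriv l (F r)) *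
          det (upd_row (upd_row ?M i (axis k 1)) r (axis l 1)))"
      by (rule sum.mono_neutral_cong_right) auto
    finally show ?thesis .
  qed
  have zero: "(\<Sum>k\<in>UNIV. \<Sum>l\<in>UNIV. partial_deriv k (partial_deriv l (F r)) *
          det (upd_row (upd_row ?M i (axis k 1)) r (axis l 1))) = 0" (is "?S = 0") if "r \<noteq> i" for r
  proof (rule cpoly_eq_uminus_self)
    have "?S = (\<Sum>k\<in>UNIV. \<Sum>l\<in>UNIV. partial_deriv l (partial_deriv k (F r)) *
          det (upd_row (upd_row ?M i (axis l 1)) r (axis k 1)))"
      by (rule sum.swap)
    also have "\<dots> = (\<Sum>k\<in>UNIV. \<Sum>l\<in>UNIV. - (partial_deriv k (partial_deriv l (F r)) *
          det (upd_row (upd_row ?M i (axis k 1)) r (axis l 1))))"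
    proof (intro sum.cong refl)
      fix k l :: 'n
      show "partial_deriv l (partial_deriv k (F r)) *
          det (upd_row (upd_row ?M i (axis l 1)) r (axis k 1)) =
        - (partial_deriv k (partial_deriv l (F r)) *
          det (upd_row (upd_row ?M i (axis k 1)) r (axis l 1)))"
        using det_swap_rows[of i r ?M "axis l 1" "axis k 1"] that
        by (simp add: partial_commute[of l k])
    qed
    finally show "?S = - ?S" by (simp add: sum_negf)
  qed
  have "(\<Sum>k\<in>UNIV. partial_deriv k (det (upd_row ?M i (axis k 1)))) =
     (\<Sum>r\<in>UNIV - {i}. \<Sum>k\<in>UNIV. \<Sum>l\<in>UNIV. partial_deriv k (partial_deriv l (F r)) *
          det (upd_row (upd_row ?M i (axis k 1)) r (axis l 1)))"
    unfolding step by (rule sum.swap)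
  also have "\<dots> = 0"
    by (rule sum.neutral) (simp add: zero)
  finally show ?thesis .
qed

definition directional :: "complex ^ 'n \<Rightarrow> ('n::finite) cpoly \<Rightarrow> 'n cpoly" where
  "directional a p = (\<Sum>k\<in>UNIV. const (a $ k) * partial_deriv k p)"

lemma eval_const [simp]: "eval_poly (const c) v = c"
  by simp

lemma eval_directional: "eval_poly (directional a p) x = (\<Sum>k\<in>UNIV. a $ k * eval_poly (partial_deriv k p) x)"
  by (simp add: directional_def)

lemma directional_axis [simp]: "directional (axis k 1) p = partial_deriv k p"
proof -
  have "directional (axis k 1) p = (\<Sum>j\<in>UNIV. if j = k then partial_deriv j p else 0)"
    unfolding directional_def by (intro sum.cong) (auto simp: axis_def)
  then show ?thesis by simp
qed

lemma eval_has_field_derivative: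
  "((\<lambda>t. eval_poly p (x + t *s a)) has_field_derivative eval_poly (directional a p) (x + t *s a)) (at t)"
proof (induction p rule: cpoly_ring_induct)
  case (const c)
  have "directional a (const c) = 0" unfolding directional_def by simp
  then show ?case by (simp del: eval_single add: eval_const)
next
  case (Var i)
  have "eval_poly (directional a (Var i)) y = a $ i" for y
    unfolding eval_directional
    by (simp add: if_distrib[of "\<lambda>p. eval_poly p _"] if_distrib[of "\<lambda>x. _ * x"] cong: if_cong)
  then show ?case by (auto intro!: derivative_eq_intros)
next
  case (add f g)
  have "directional a (f + g) = directional a f + directional a g"
    by (simp add: directional_def distrib_left sum.distrib)
  with add show ?case by (auto intro!: derivative_eq_intros)
next
  case (mult f g)
  have "directional a (f * g) = directional a f * g + f * directional a g"
    by (simp add: directional_def partial_mult distrib_left sum.distrib sum_distrib_left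
        sum_distrib_right mult_ac)
  with mult show ?case by (auto intro!: derivative_eq_intros)
qed

lemma scaleR_smult: "t *\<^sub>R (c *s a) = (of_real t * c) *s (a :: complex ^ 'n)"
  unfolding vec_eq_iff vector_scaleR_component vector_smult_component
  by (simp add: scaleR_conv_of_real)

lemma eval_has_vector_derivative:
  "((\<lambda>t. eval_poly p (x + t *\<^sub>R (c *s a))) has_vector_derivative
      c * eval_poly (directional a p) (x + t *\<^sub>R (c *s a))) (at t)"
proof -
  have "((\<lambda>z. eval_poly p (x + (z * c) *s a)) has_field_derivative
      eval_poly (directional a p) (x + (of_real t * c) *s a) * c) (at (of_real t))"
    by (rule DERIV_chain2[OF eval_has_field_derivative]) (auto intro!: derivative_eq_intros)
  from has_vector_derivative_real_field[OF this] show ?thesis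
    by (simp add: scaleR_smult mult.commute)
qed

lemma continuous_on_eval [continuous_intros]:
  "continuous_on S g \<Longrightarrow> continuous_on S (\<lambda>x. eval_poly p (g x))"
  unfolding eval_poly_def by (intro continuous_intros)

lemma integral_translation_invariant:
  fixes u :: "'a::euclidean_space \<Rightarrow> complex"
  assumes "u \<in> borel_measurable borel"
  shows "integral\<^sup>L lborel (\<lambda>x. u (c + x)) = integral\<^sup>L lborel u"
proof -
  have "integral\<^sup>L lborel u = integral\<^sup>L (distr lborel borel ((+) c)) u"
    by (simp add: lborel_distr_plus)
  also have "\<dots> = integral\<^sup>L lborel (\<lambda>x. u (c + x))"
    by (rule integral_distr) (use assms in auto)
  finally show ?thesis by simp
qed

lemma integrable_compact_support:
  fixes u :: "'a::euclidean_space \<Rightarrow> 'b::{banach, second_countable_topology}"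
  assumes "continuous_on UNIV u" and "\<And>x. norm x > R \<Longrightarrow> u x = 0"
  shows "integrable lborel u"
proof -
  have "integrable lborel (\<lambda>x. indicator (cball 0 R) x *\<^sub>R u x)"
    using assms(1) by (intro borel_integrable_compact) (auto intro: continuous_on_subset)
  moreover have "(\<lambda>x. indicator (cball 0 R) x *\<^sub>R u x) = u"
    using assms(2) by (fastforce simp: indicator_def)
  ultimately show ?thesis by simp
qed

text \<open>
  Difference quotients of \<open>u\<close> have integral zero because Lebesgue measure is translation
  invariant. They converge to \<open>u'\<close>, dominated by a bound of \<open>u'\<close> on a slightly larger ball.
\<close>

lemma integral_directional_derivative_eq_0:
  fixes u u' :: "'a::euclidean_space \<Rightarrow> complex"
  assumes cont: "continuous_on UNIV u" "continuous_on UNIV u'"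
    and deriv: "\<And>x t. ((\<lambda>t. u (x + t *\<^sub>R e)) has_vector_derivative u' (x + t *\<^sub>R e)) (at t)"
    and supp: "\<And>x. norm x > R \<Longrightarrow> u x = 0" "\<And>x. norm x > R \<Longrightarrow> u' x = 0"
  shows "integral\<^sup>L lborel u' = 0"
proof -
  define h where "h n = inverse (real (Suc n))" for n
  define s where "s n x = (1 / h n) *\<^sub>R (u (h n *\<^sub>R e + x) - u x)" for n x
  have h: "0 < h n" "h n \<le> 1" for n by (auto simp: h_def field_simps)
  have meas: "u \<in> borel_measurable borel" "u' \<in> borel_measurable borel"
    using cont by (simp_all add: borel_measurable_continuous_onI)
  have ms: "s n \<in> borel_measurable borel" for n
    unfolding s_def by (rule borel_measurable_continuous_onI)
      (intro continuous_intros continuous_on_compose2[OF cont(1)] cont(1) subset_UNIV)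
  have "bounded (u' ` cball 0 R)"
    using cont(2) by (intro compact_imp_bounded compact_continuous_image)
      (auto intro: continuous_on_subset)
  then obtain B0 where "\<forall>y\<in>u' ` cball 0 R. norm y \<le> B0"
    unfolding bounded_iff by blast
  then have B0: "norm (u' x) \<le> B0" if "norm x \<le> R" for x
    using that by simp
  define B where "B = max 0 B0"
  have B: "norm (u' x) \<le> B" for x
    using B0[of x] supp(2)[of x] unfolding B_def by (cases "norm x \<le> R") auto
  have lip: "norm (u (x + t *\<^sub>R e) - u x) \<le> B * \<bar>t\<bar>" for x t
  proof -
    have "norm (u (x + t *\<^sub>R e) - u (x + 0 *\<^sub>R e)) \<le> B * norm (t - 0)"
    proof (rule differentiable_bound[of UNIV "\<lambda>t. u (x + t *\<^sub>R e)" "\<lambda>t h. h *\<^sub>R u' (x + t *\<^sub>R e)"])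
      fix t :: real
      show "((\<lambda>t. u (x + t *\<^sub>R e)) has_derivative (\<lambda>h. h *\<^sub>R u' (x + t *\<^sub>R e))) (at t within UNIV)"
        using deriv[of x t] by (simp add: has_vector_derivative_def)
      show "onorm (\<lambda>h. h *\<^sub>R u' (x + t *\<^sub>R e)) \<le> B"
        by (rule onorm_le) (use B in \<open>simp add: mult.commute[of B] mult_left_mono\<close>)
    qed auto
    then show ?thesis by simp
  qed
  have "(\<lambda>n. integral\<^sup>L lborel (s n)) \<longlonglongrightarrow> integral\<^sup>L lborel u'"
  proof (rule integral_dominated_convergence)
    show "integrable lborel (\<lambda>x::'a. indicator (cball 0 (R + norm e)) x *\<^sub>R B)"
      by (rule borel_integrable_compact) auto
    show "AE x in lborel. (\<lambda>n. s n x) \<longlonglongrightarrow> u' x"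
    proof (rule AE_I2)
      fix x
      have "((\<lambda>t. u (x + t *\<^sub>R e)) has_derivative (\<lambda>t. t *\<^sub>R u' x)) (at 0)"
        using deriv[of x 0] by (simp add: has_vector_derivative_def)
      then have "((\<lambda>t. norm (u (x + t *\<^sub>R e) - u x - t *\<^sub>R u' x) / norm t) \<longlongrightarrow> 0) (at 0)"
        by (simp add: has_derivative_iff_norm)
      moreover have "filterlim h (at 0) sequentially"
        unfolding filterlim_at
      proof
        show "h \<longlonglongrightarrow> 0"
          unfolding h_def[abs_def] by (rule LIMSEQ_inverse_real_of_nat)
        show "\<forall>\<^sub>F n in sequentially. h n \<in> UNIV \<and> h n \<noteq> 0"
          using h(1) by (auto simp: less_imp_neq[symmetric])
      qed
      ultimately have "(\<lambda>n. norm (u (x + h n *\<^sub>R e) - u x - h n *\<^sub>R u' x) / norm (h n)) \<longlonglongrightarrow> 0"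
        by (rule filterlim_compose)
      moreover have "norm (u (x + h n *\<^sub>R e) - u x - h n *\<^sub>R u' x) / norm (h n) = norm (s n x - u' x)" for n
      proof -
        have "s n x - u' x = (1 / h n) *\<^sub>R (u (x + h n *\<^sub>R e) - u x - h n *\<^sub>R u' x)"
          using h(1)[of n] by (simp add: s_def add.commute scaleR_diff_right)
        then show ?thesis using h(1)[of n] by (simp del: scaleR_diff_right)
      qed
      ultimately show "(\<lambda>n. s n x) \<longlonglongrightarrow> u' x"
        by (simp add: tendsto_norm_zero_iff LIM_zero_iff)
    qed
    show "AE x in lborel. norm (s n x) \<le> indicator (cball 0 (R + norm e)) x *\<^sub>R B" for n
    proof (rule AE_I2)
      fix x
      show "norm (s n x) \<le> indicator (cball 0 (R + norm e)) x *\<^sub>R B"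
      proof (cases "norm x \<le> R + norm e")
        case True
        have "norm (s n x) \<le> B"
          using lip[of x "h n"] h(1)[of n] by (simp add: s_def add.commute pos_divide_le_eq)
        with True show ?thesis by simp
      next
        case False
        have "norm (h n *\<^sub>R e) \<le> norm e" using h[of n] by (simp add: mult_left_le_one_le)
        moreover have "norm x \<le> norm (h n *\<^sub>R e + x) + norm (h n *\<^sub>R e)"
          using norm_triangle_ineq4[of "h n *\<^sub>R e + x" "h n *\<^sub>R e"] by simp
        ultimately have "norm (h n *\<^sub>R e + x) > R" using False by simp
        moreover have "norm x > R" using False norm_ge_zero[of e] by linarith
        ultimately show ?thesis using supp(1) False by (simp add: s_def)
      qed
    qed
  qed (use meas ms in auto)
  moreover have "integral\<^sup>L lborel (s n) = 0" for n
  proof -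
    have i: "integrable lborel u" by (rule integrable_compact_support[OF cont(1) supp(1)])
    have "integrable lborel (\<lambda>x. u (h n *\<^sub>R e + x))"
    proof (rule integrable_compact_support)
      show "continuous_on UNIV (\<lambda>x. u (h n *\<^sub>R e + x))"
        by (intro continuous_intros continuous_on_compose2[OF cont(1)] subset_UNIV)
      fix x :: 'a assume "norm x > R + norm (h n *\<^sub>R e)"
      moreover have "norm x \<le> norm (h n *\<^sub>R e + x) + norm (h n *\<^sub>R e)"
        using norm_triangle_ineq4[of "h n *\<^sub>R e + x" "h n *\<^sub>R e"] by simp
      ultimately show "u (h n *\<^sub>R e + x) = 0" using supp(1) by simp
    qed
    with i show ?thesis
      unfolding s_def using integral_translation_invariant[OF meas(1)] by simp
  qed
  ultimately show ?thesis by (simp add: LIMSEQ_const_iff)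
qed

text \<open>
  Stokes' theorem for one coordinate: \<open>v\<close> is the derivative with respect to the conjugate of
  \<open>x\<^sub>k\<close> of \<open>G\<close> times the conjugate of \<open>A\<close> times \<open>\<phi>(|F|\<^sup>2)\<close>. It is half of the derivative in the
  direction \<open>e\<^sub>k\<close> plus \<open>\<i>\<close> times the derivative in the direction \<open>\<i> e\<^sub>k\<close>, a combination that
  annihilates holomorphic factors.
\<close>

lemma integral_dbar_eq_0:
  fixes F :: "'n::finite \<Rightarrow> 'n cpoly" and G A :: "'n cpoly" and k :: 'n and \<phi> \<phi>' :: "real \<Rightarrow> real"
  defines "s \<equiv> \<lambda>x. \<Sum>j\<in>UNIV. (cmod (eval_poly (F j) x))\<^sup>2"
  assumes phi: "\<And>t. (\<phi> has_real_derivative \<phi>' t) (at t)" "continuous_on UNIV \<phi>'"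
    and supp: "\<And>x. norm x > R \<Longrightarrow> \<phi> (s x) = 0" "\<And>x. norm x > R \<Longrightarrow> \<phi>' (s x) = 0"
  defines "v \<equiv> \<lambda>x. eval_poly G x * cnj (eval_poly (partial_deriv k A) x) * of_real (\<phi> (s x)) +
      eval_poly G x * cnj (eval_poly A x) * of_real (\<phi>' (s x)) *
        (\<Sum>j\<in>UNIV. eval_poly (F j) x * cnj (eval_poly (partial_deriv k (F j)) x))"
  shows "integrable lborel v" "integral\<^sup>L lborel v = 0"
proof -
  have cphi: "continuous_on UNIV \<phi>"
    using phi(1) by (auto intro!: continuous_at_imp_continuous_on DERIV_isCont)
  define T where "T x = (\<Sum>j\<in>UNIV. eval_poly (F j) x * cnj (eval_poly (partial_deriv k (F j)) x))" for x
  define u where "u x = eval_poly G x * cnj (eval_poly A x) * of_real (\<phi> (s x))" for x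
  define u' where "u' c x = c * eval_poly (partial_deriv k G) x * cnj (eval_poly A x) * of_real (\<phi> (s x)) +
     eval_poly G x * (cnj c * cnj (eval_poly (partial_deriv k A) x)) * of_real (\<phi> (s x)) +
     eval_poly G x * cnj (eval_poly A x) * of_real (\<phi>' (s x) * (2 * Re (cnj c * T x)))" for c x
  have cs: "continuous_on UNIV s" unfolding s_def by (intro continuous_intros)
  have cu: "continuous_on UNIV u"
    unfolding u_def by (intro continuous_intros continuous_on_compose2[OF cphi] cs subset_UNIV)
  have cu': "continuous_on UNIV (u' c)" for c
    unfolding u'_def T_def
    by (intro continuous_intros continuous_on_compose2[OF cphi] continuous_on_compose2[OF phi(2)] cs subset_UNIV)
  have du: "((\<lambda>t. u (x + t *\<^sub>R (c *s axis k 1))) has_vector_derivative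
      u' c (x + t *\<^sub>R (c *s axis k 1))) (at t)" for c x t
  proof -
    let ?y = "\<lambda>t. x + t *\<^sub>R (c *s axis k (1::complex))"
    note ev = eval_has_vector_derivative[where a = "axis k 1", unfolded directional_axis, of _ x c t]
    have "((\<lambda>t. \<Sum>j\<in>UNIV. eval_poly (F j) (?y t) * cnj (eval_poly (F j) (?y t)))
        has_vector_derivative (\<Sum>j\<in>UNIV.
          eval_poly (F j) (?y t) * cnj (c * eval_poly (partial_deriv k (F j)) (?y t)) +
          c * eval_poly (partial_deriv k (F j)) (?y t) * cnj (eval_poly (F j) (?y t)))) (at t)"
      by (intro has_vector_derivative_sum has_vector_derivative_mult has_vector_derivative_cnj ev)
    from bounded_linear.has_vector_derivative[OF bounded_linear_Re this]
    have "((\<lambda>t. s (?y t)) has_vector_derivative 2 * Re (cnj c * T (?y t))) (at t)"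
      by (simp add: s_def T_def complex_mult_cnj cmod_power2 sum_distrib_left algebra_simps sum.distrib)
    then have ds: "((\<lambda>t. s (?y t)) has_real_derivative 2 * Re (cnj c * T (?y t))) (at t)"
      by (simp add: has_real_derivative_iff_has_vector_derivative)
    have "((\<lambda>t. \<phi> (s (?y t))) has_real_derivative \<phi>' (s (?y t)) * (2 * Re (cnj c * T (?y t)))) (at t)"
      by (rule DERIV_chain2[OF phi(1) ds])
    then have dp: "((\<lambda>t. complex_of_real (\<phi> (s (?y t)))) has_vector_derivative
        of_real (\<phi>' (s (?y t)) * (2 * Re (cnj c * T (?y t))))) (at t)"
      by (intro has_vector_derivative_of_real) (simp add: has_real_derivative_iff_has_vector_derivative)
    show ?thesis
      unfolding u_def u'_def
      by (rule has_vector_derivative_eq_rhs[OF has_vector_derivative_mult[OF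
            has_vector_derivative_mult[OF ev has_vector_derivative_cnj[OF ev]] dp]])
         (simp add: algebra_simps)
  qed
  have sup: "u x = 0" "u' c x = 0" if "norm x > R" for c x
    using supp[OF that] by (simp_all add: u_def u'_def)
  have int0: "integral\<^sup>L lborel (u' c) = 0" for c
    by (rule integral_directional_derivative_eq_0[OF cu cu' du sup])
  have inte: "integrable lborel (u' c)" for c
    by (rule integrable_compact_support[OF cu' sup(2)])
  have v: "v = (\<lambda>x. (1/2) * (u' 1 x + \<i> * u' \<i> x))"
  proof
    fix x
    have "complex_of_real (2 * Re (T x)) + \<i> * of_real (2 * Re (- \<i> * T x)) = 2 * T x"
      by (simp add: complex_eq_iff)
    then have T: "\<i> * complex_of_real (2 * Re (- \<i> * T x)) = 2 * T x - complex_of_real (2 * Re (T x))"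
      by (simp add: algebra_simps)
    have "\<i> * u' \<i> x = - (eval_poly (partial_deriv k G) x * cnj (eval_poly A x) * of_real (\<phi> (s x))) +
       eval_poly G x * cnj (eval_poly (partial_deriv k A) x) * of_real (\<phi> (s x)) +
       eval_poly G x * cnj (eval_poly A x) * of_real (\<phi>' (s x)) * (\<i> * of_real (2 * Re (- \<i> * T x)))"
      unfolding u'_def by (simp add: algebra_simps)
    then show "v x = (1/2) * (u' 1 x + \<i> * u' \<i> x)"
      unfolding T unfolding v_def T_def[symmetric] u'_def by (simp add: algebra_simps)
  qed
  show "integrable lborel v" unfolding v using inte by simp
  show "integral\<^sup>L lborel v = 0" unfolding v using inte int0 by simp
qed

section \<open>Jacobian determinants of systems without common zeros\<close>

abbreviation norm_sq :: "('n::finite \<Rightarrow> 'n cpoly) \<Rightarrow> complex ^ 'n \<Rightarrow> real" where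
  "norm_sq F x \<equiv> \<Sum>j\<in>UNIV. (cmod (eval_poly (F j) x))\<^sup>2"

text \<open>
  The integrals of \<open>integral_dbar_eq_0\<close>, with \<open>A\<close> the \<open>(i, k)\<close> cofactor, add up over \<open>k\<close>: the
  terms with \<open>\<phi>\<close> cancel by the Piola identity, and in the terms with \<open>\<phi>'\<close> the adjugate
  identity leaves \<open>F i\<close> times the conjugate Jacobian determinant.
\<close>

lemma integral_residue_kills_ideal:
  fixes F :: "'n::finite \<Rightarrow> 'n cpoly" and G :: "'n cpoly" and i :: 'n and \<phi> \<phi>' :: "real \<Rightarrow> real"
  assumes phi: "\<And>t. (\<phi> has_real_derivative \<phi>' t) (at t)" "continuous_on UNIV \<phi>'"
    and supp: "\<And>x. norm x > R \<Longrightarrow> \<phi> (norm_sq F x) = 0" "\<And>x. norm x > R \<Longrightarrow> \<phi>' (norm_sq F x) = 0"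
  defines "w \<equiv> \<lambda>x. eval_poly (G * F i) x * cnj (eval_poly (det (jacobian_matrix F)) x) *
      complex_of_real (\<phi>' (norm_sq F x))"
  shows "integrable lborel w" "integral\<^sup>L lborel w = 0"
proof -
  let ?M = "jacobian_matrix F"
  define A where "A k = det (upd_row ?M i (axis k 1))" for k
  define v where "v k x = eval_poly G x * cnj (eval_poly (partial_deriv k (A k)) x) *
        complex_of_real (\<phi> (norm_sq F x)) +
      eval_poly G x * cnj (eval_poly (A k) x) * complex_of_real (\<phi>' (norm_sq F x)) *
        (\<Sum>j\<in>UNIV. eval_poly (F j) x * cnj (eval_poly (partial_deriv k (F j)) x))" for k x
  have v: "integrable lborel (v k)" "integral\<^sup>L lborel (v k) = 0" for k
    unfolding v_def
    using integral_dbar_eq_0[of \<phi> \<phi>' R F G k "A k", OF phi supp] by simp_all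
  have w: "w = (\<lambda>x. \<Sum>k\<in>UNIV. v k x)"
  proof
    fix x
    have div: "(\<Sum>k\<in>UNIV. eval_poly (partial_deriv k (A k)) x) = 0"
      using jacobian_cofactor_divergence_free[of F i] unfolding A_def[symmetric]
      by (metis eval_0 eval_sum)
    have cof: "(\<Sum>k\<in>UNIV. eval_poly (partial_deriv k (F j)) x * eval_poly (A k) x) =
        (if i = j then eval_poly (det ?M) x else 0)" for j
    proof -
      have "eval_poly (\<Sum>k\<in>UNIV. ?M $ j $ k * A k) x = (if i = j then eval_poly (det ?M) x else 0)"
        unfolding A_def row_cofactor_expansion by simp
      then show ?thesis by (simp add: jacobian_matrix_def)
    qed
    have "(\<Sum>k\<in>UNIV. v k x) =
      eval_poly G x * complex_of_real (\<phi> (norm_sq F x)) *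
        cnj (\<Sum>k\<in>UNIV. eval_poly (partial_deriv k (A k)) x) +
      eval_poly G x * complex_of_real (\<phi>' (norm_sq F x)) *
        (\<Sum>k\<in>UNIV. \<Sum>j\<in>UNIV. eval_poly (F j) x *
            cnj (eval_poly (partial_deriv k (F j)) x * eval_poly (A k) x))"
      unfolding v_def sum.distrib cnj_sum sum_distrib_left complex_cnj_mult
      by (simp only: mult_ac)
    also have "(\<Sum>k\<in>UNIV. \<Sum>j\<in>UNIV. eval_poly (F j) x *
            cnj (eval_poly (partial_deriv k (F j)) x * eval_poly (A k) x)) =
        (\<Sum>j\<in>UNIV. eval_poly (F j) x *
            cnj (\<Sum>k\<in>UNIV. eval_poly (partial_deriv k (F j)) x * eval_poly (A k) x))"
      unfolding cnj_sum sum_distrib_left by (rule sum.swap)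
    also have "\<dots> = eval_poly (F i) x * cnj (eval_poly (det ?M) x)"
      unfolding cof by (simp add: if_distrib[of cnj] if_distrib[of "\<lambda>y. _ * y"] cong: if_cong)
    finally show "w x = (\<Sum>k\<in>UNIV. v k x)"
      unfolding w_def div by simp
  qed
  show "integrable lborel w" unfolding w using v by simp
  show "integral\<^sup>L lborel w = 0" unfolding w using v by simp
qed

lemma truncated_square_has_derivative:
  fixes K t :: real
  shows "((\<lambda>t. (max 0 (K - t))\<^sup>2) has_real_derivative - 2 * max 0 (K - t)) (at t)"
proof -
  consider "t < K" | "t > K" | "t = K" by linarith
  then show ?thesis
  proof cases
    case 1
    have "((\<lambda>t. (K - t)\<^sup>2) has_real_derivative - 2 * max 0 (K - t)) (at t)"
      using 1 by (auto intro!: derivative_eq_intros)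
    then show ?thesis
      by (rule has_field_derivative_transform_within_open[where S = "{..<K}"]) (use 1 in auto)
  next
    case 2
    have "((\<lambda>t. 0) has_real_derivative - 2 * max 0 (K - t)) (at t)"
      using 2 by auto
    then show ?thesis
      by (rule has_field_derivative_transform_within_open[where S = "{K<..}"]) (use 2 in auto)
  next
    case 3
    have "((\<lambda>h::real. - max 0 (- h)) \<longlongrightarrow> - max 0 (- 0)) (at 0)"
      by (intro tendsto_intros)
    then have "((\<lambda>h::real. - max 0 (- h)) \<longlongrightarrow> 0) (at 0)" by simp
    moreover have "((max 0 (K - (t + h)))\<^sup>2 - (max 0 (K - t))\<^sup>2) / h = - max 0 (- h)" for h
      using 3 by (auto simp: max_def power2_eq_square)
    ultimately have "((\<lambda>h. ((max 0 (K - (t + h)))\<^sup>2 - (max 0 (K - t))\<^sup>2) / h) \<longlongrightarrow> 0) (at 0)"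
      by simp
    with 3 show ?thesis by (simp add: DERIV_def)
  qed
qed

lemma continuous_nonneg_integral_eq_0:
  fixes q :: "'a::euclidean_space \<Rightarrow> real"
  assumes cont: "continuous_on UNIV q" and nonneg: "\<And>x. q x \<ge> 0"
    and int: "integrable lborel q" "integral\<^sup>L lborel q = 0"
  shows "q x = 0"
proof -
  let ?S = "{x. q x \<noteq> 0}"
  have op: "open ?S"
    using cont by (intro open_Collect_neq) (auto intro: continuous_on_const)
  have "AE x in lborel. q x = 0"
    using integral_nonneg_eq_0_iff_AE[OF int(1)] int(2) nonneg by simp
  then have "?S \<in> null_sets lborel"
    using op AE_iff_measurable[of ?S lborel "\<lambda>x. q x = 0"] by (auto simp: null_sets_def)
  then have "negligible ?S"
    by (simp add: negligible_iff_null_sets null_sets_completionI)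
  with op have "?S = {}" using open_not_negligible by blast
  then show ?thesis by blast
qed

text \<open>
  The minimum of \<open>|F|\<^sup>2\<close> on the unit sphere is positive and spreads by homogeneity.
\<close>

lemma homogeneous_system_lower_bound:
  fixes F :: "'n::finite \<Rightarrow> 'n cpoly"
  assumes hom: "\<And>i. homogeneous_poly (Suc e) (F i)"
    and zero: "\<And>v. (\<And>i. eval_poly (F i) v = 0) \<Longrightarrow> v = 0"
  shows "\<exists>c>0. \<forall>x. norm x \<ge> 1 \<longrightarrow> c * (norm x)\<^sup>2 \<le> norm_sq F x"
proof -
  let ?S = "sphere (0 :: complex ^ 'n) 1"
  have ne: "?S \<noteq> {}" by auto
  have "continuous_on ?S (norm_sq F)" by (intro continuous_intros)
  from continuous_attains_inf[OF compact_sphere ne this]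
  obtain y where y: "y \<in> ?S" "\<And>x. x \<in> ?S \<Longrightarrow> norm_sq F y \<le> norm_sq F x" by blast
  have "norm_sq F y \<noteq> 0"
  proof
    assume "norm_sq F y = 0"
    then have "eval_poly (F i) y = 0" for i by (simp add: sum_nonneg_eq_0_iff)
    then have "y = 0" by (rule zero)
    with y(1) show False by simp
  qed
  then have pos: "norm_sq F y > 0" by (simp add: sum_nonneg less_le)
  have "norm_sq F y * (norm x)\<^sup>2 \<le> norm_sq F x" if x: "norm x \<ge> 1" for x
  proof -
    define z where "z = (1 / norm x) *\<^sub>R x"
    have "norm x \<noteq> 0" using x by linarith
    then have z: "z \<in> ?S" "x = complex_of_real (norm x) *s z"
      using scaleR_smult[of "norm x" 1 z] by (simp_all add: z_def)
    have "norm_sq F x = ((norm x)\<^sup>2) ^ Suc e * norm_sq F z"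
    proof -
      have "(cmod (eval_poly (F j) x))\<^sup>2 = ((norm x)\<^sup>2) ^ Suc e * (cmod (eval_poly (F j) z))\<^sup>2" for j
        by (subst z(2), subst eval_homogeneous_scale[OF hom])
           (simp add: norm_mult norm_power power_mult_distrib power_mult[symmetric] mult.commute
              del: power_Suc)
      then show ?thesis by (simp add: sum_distrib_left)
    qed
    moreover have "(norm x)\<^sup>2 \<le> ((norm x)\<^sup>2) ^ Suc e"
      using x by (simp add: self_le_power del: power_Suc)
    then have "norm_sq F y * (norm x)\<^sup>2 \<le> norm_sq F z * ((norm x)\<^sup>2) ^ Suc e"
      by (intro mult_mono y(2) z(1) sum_nonneg zero_le_power2)
    ultimately show ?thesis by (simp only: mult.commute)
  qed
  with pos show ?thesis by blast
qed

lemma second_derivative_at_maximum: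
  fixes g g' :: "real \<Rightarrow> real"
  assumes g: "\<And>t. (g has_real_derivative g' t) (at t)" and g': "(g' has_real_derivative l) (at 0)"
    and max: "\<And>t. g t \<le> g 0"
  shows "l \<le> 0"
proof (rule ccontr)
  assume "\<not> l \<le> 0"
  with DERIV_pos_inc_right[OF g'] obtain d where d: "d > 0" "\<And>h. 0 < h \<Longrightarrow> h < d \<Longrightarrow> g' 0 < g' h"
    by auto
  have "g' 0 = 0"
    by (rule DERIV_local_max[OF g, of 1]) (use max in auto)
  have "g 0 < g (d / 2)"
  proof (rule DERIV_pos_imp_increasing_open[where f = g])
    show "\<exists>y. DERIV g t :> y \<and> 0 < y" if "0 < t" "t < d / 2" for t
      using d(2)[of t] that \<open>g' 0 = 0\<close> g[of t] by auto
    show "continuous_on {0..d / 2} g"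
      by (rule continuous_at_imp_continuous_on) (use DERIV_isCont[OF g] in blast)
  qed (use d(1) in simp)
  with max[of "d / 2"] show False by simp
qed

text \<open>
  A kernel vector \<open>a\<close> of the Jacobian matrix at the maximum of \<open>(c/2) |x|\<^sup>2 - |F|\<^sup>2\<close> gives a
  complex line on which \<open>F\<close> has no linear term. The second derivatives of \<open>|F|\<^sup>2\<close> in the real
  directions \<open>a\<close> and \<open>\<i> a\<close> then cancel, while those of \<open>|x|\<^sup>2\<close> are both positive.
\<close>

lemma jacobian_not_identically_zero:
  fixes F :: "'n::finite \<Rightarrow> 'n cpoly"
  assumes hom: "\<And>i. homogeneous_poly (Suc e) (F i)"
    and zero: "\<And>v. (\<And>i. eval_poly (F i) v = 0) \<Longrightarrow> v = 0"
  shows "\<exists>x. eval_poly (det (jacobian_matrix F)) x \<noteq> 0"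
proof -
  obtain c where c: "c > 0" "\<And>x. norm x \<ge> 1 \<Longrightarrow> c * (norm x)\<^sup>2 \<le> norm_sq F x"
    using homogeneous_system_lower_bound[of e F, OF hom zero] by blast
  define \<psi> where "\<psi> x = (c / 2) * (norm x)\<^sup>2 - norm_sq F x" for x
  have "continuous_on (cball 0 1) \<psi>" unfolding \<psi>_def by (intro continuous_intros)
  from continuous_attains_sup[OF compact_cball _ this]
  obtain x where "\<forall>y\<in>cball 0 1. \<psi> y \<le> \<psi> x" by auto
  then have x: "\<psi> y \<le> \<psi> x" if "norm y \<le> 1" for y
    using that by simp
  have "\<psi> 0 = 0"
  proof -
    have "eval_poly (F i) 0 = 0" for i
      using eval_homogeneous_scale[OF hom, of i 0 0] by simp
    then show ?thesis by (simp add: \<psi>_def)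
  qed
  have max: "\<psi> y \<le> \<psi> x" for y
  proof (cases "norm y \<le> 1")
    case False
    then have "\<psi> y \<le> - (c / 2) * (norm y)\<^sup>2"
      using c(2)[of y] by (simp add: \<psi>_def)
    also have "\<dots> \<le> 0" using c(1) by simp
    also have "0 \<le> \<psi> x" using x[of 0] \<open>\<psi> 0 = 0\<close> by simp
    finally show ?thesis .
  qed (rule x)
  have "eval_poly (det (jacobian_matrix F)) x \<noteq> 0"
  proof
    assume "eval_poly (det (jacobian_matrix F)) x = 0"
    then have "det (\<chi> i j. eval_poly (partial_deriv j (F i)) x) = 0"
      by (simp add: eval_det jacobian_matrix_def)
    then have "\<not> invertible (\<chi> i j. eval_poly (partial_deriv j (F i)) x)"
      by (simp add: invertible_det_nz)
    then obtain a where a: "a \<noteq> 0" "(\<chi> i j. eval_poly (partial_deriv j (F i)) x) *v a = 0"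
      using matrix_left_invertible_ker invertible_left_inverse by blast
    then have ker: "eval_poly (directional a (F i)) x = 0" for i
      by (simp add: eval_directional vec_eq_iff matrix_vector_mult_def mult.commute)
    let ?W = "\<Sum>j\<in>UNIV. eval_poly (directional a (directional a (F j))) x * cnj (eval_poly (F j) x)"
    \<comment> \<open>The second derivative along the real line through \<open>x\<close> in the direction \<open>b a\<close>.\<close>
    have bound: "c * (norm (b *s a))\<^sup>2 - 2 * Re (b\<^sup>2 * ?W) \<le> 0" for b
    proof (rule second_derivative_at_maximum)
      let ?y = "\<lambda>t. x + t *\<^sub>R (b *s a)"
      let ?g = "\<lambda>t. \<psi> (?y t)"
      let ?T = "\<lambda>t. \<Sum>j\<in>UNIV. b * eval_poly (directional a (F j)) (?y t) * cnj (eval_poly (F j) (?y t))"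
      let ?g' = "\<lambda>t. c * ((b *s a) \<bullet> x + t * (norm (b *s a))\<^sup>2) - 2 * Re (?T t)"
      have psi: "?g t = (c / 2) * ((norm x)\<^sup>2 + 2 * t * ((b *s a) \<bullet> x) + t\<^sup>2 * (norm (b *s a))\<^sup>2)
          - Re (\<Sum>j\<in>UNIV. eval_poly (F j) (?y t) * cnj (eval_poly (F j) (?y t)))" for t
      proof -
        have "norm_sq F (?y t) = Re (\<Sum>j\<in>UNIV. eval_poly (F j) (?y t) * cnj (eval_poly (F j) (?y t)))"
          by (simp only: complex_norm_square[symmetric] of_real_sum[symmetric] Re_complex_of_real)
        moreover have "(norm (?y t))\<^sup>2 =
            (norm x)\<^sup>2 + 2 * t * ((b *s a) \<bullet> x) + t\<^sup>2 * (norm (b *s a))\<^sup>2"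
          unfolding power2_norm_eq_inner
          by (simp add: inner_simps inner_commute power2_eq_square algebra_simps)
        ultimately show ?thesis by (simp only: \<psi>_def)
      qed
      note ev = eval_has_vector_derivative[of _ x b a]
      have d1: "((\<lambda>t. Re (\<Sum>j\<in>UNIV. eval_poly (F j) (?y t) * cnj (eval_poly (F j) (?y t))))
          has_real_derivative 2 * Re (?T t)) (at t)" for t
      proof -
        have "((\<lambda>t. \<Sum>j\<in>UNIV. eval_poly (F j) (?y t) * cnj (eval_poly (F j) (?y t)))
          has_vector_derivative (\<Sum>j\<in>UNIV.
            eval_poly (F j) (?y t) * cnj (b * eval_poly (directional a (F j)) (?y t)) +
            b * eval_poly (directional a (F j)) (?y t) * cnj (eval_poly (F j) (?y t)))) (at t)"
          by (intro has_vector_derivative_sum has_vector_derivative_mult has_vector_derivative_cnj ev)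
        from bounded_linear.has_vector_derivative[OF bounded_linear_Re this]
        show ?thesis
          unfolding has_real_derivative_iff_has_vector_derivative
          by (rule has_vector_derivative_eq_rhs) (simp add: sum.distrib sum_distrib_left algebra_simps)
      qed
      have d2: "((\<lambda>t. Re (?T t)) has_real_derivative Re (b\<^sup>2 * ?W)) (at 0)"
      proof -
        have "(?T has_vector_derivative (\<Sum>j\<in>UNIV.
            b * eval_poly (directional a (F j)) (?y 0) * cnj (b * eval_poly (directional a (F j)) (?y 0)) +
            b * (b * eval_poly (directional a (directional a (F j))) (?y 0)) * cnj (eval_poly (F j) (?y 0))))
            (at 0)"
          by (intro has_vector_derivative_sum has_vector_derivative_mult has_vector_derivative_cnj
              has_vector_derivative_mult_right ev)
        from bounded_linear.has_vector_derivative[OF bounded_linear_Re this]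
        show ?thesis
          unfolding has_real_derivative_iff_has_vector_derivative
          by (rule has_vector_derivative_eq_rhs)
             (simp add: ker sum_distrib_left power2_eq_square mult.assoc)
      qed
      show "(?g has_real_derivative ?g' t) (at t)" for t
        unfolding psi by (rule derivative_eq_intros d1 refl | simp add: algebra_simps del: Re_sum)+
      show "(?g' has_real_derivative c * (norm (b *s a))\<^sup>2 - 2 * Re (b\<^sup>2 * ?W)) (at 0)"
        by (rule derivative_eq_intros d2 refl | simp del: Re_sum)+
      show "?g t \<le> ?g 0" for t using max by simp
    qed
    have "norm (\<i> *s a) = norm a"
      by (simp add: norm_vec_def norm_mult)
    \<comment> \<open>The two mixed terms have the factors \<open>1\<^sup>2\<close> and \<open>\<i>\<^sup>2\<close> and cancel in the sum.\<close>
    with bound[of 1] bound[of \<i>] have "c * (norm a)\<^sup>2 \<le> 0" by simp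
    with c(1) a(1) show False by (simp add: mult_le_0_iff)
  qed
  then show ?thesis by blast
qed

text \<open>
  The function \<open>\<phi>(t) = (max 0 (K - t))\<^sup>2\<close> is continuously differentiable, vanishes for \<open>t \<ge> K\<close>,
  and is strictly decreasing below \<open>K\<close>. With \<open>K\<close> beyond the value of \<open>|F|\<^sup>2\<close> at a point where the
  Jacobian determinant is nonzero, the residue functional is nonzero on that determinant.
\<close>

lemma jacobian_not_in_ideal:
  fixes F :: "'n::finite \<Rightarrow> 'n cpoly"
  assumes hom: "\<And>i. homogeneous_poly (Suc e) (F i)"
    and zero: "\<And>v. (\<And>i. eval_poly (F i) v = 0) \<Longrightarrow> v = 0"
  shows "det (jacobian_matrix F) \<noteq> (\<Sum>i\<in>UNIV. G i * F i)"
proof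
  let ?J = "det (jacobian_matrix F)"
  assume J: "?J = (\<Sum>i\<in>UNIV. G i * F i)"
  obtain z where z: "eval_poly ?J z \<noteq> 0"
    using jacobian_not_identically_zero[of e F, OF hom zero] by blast
  define K where "K = norm_sq F z + 1"
  have "K > 0" "norm_sq F z < K" by (simp_all add: K_def sum_nonneg add_nonneg_pos)
  obtain c where c: "c > 0" "\<And>x. norm x \<ge> 1 \<Longrightarrow> c * (norm x)\<^sup>2 \<le> norm_sq F x"
    using homogeneous_system_lower_bound[of e F, OF hom zero] by blast
  have far: "max 0 (K - norm_sq F x) = 0" if "norm x > 1 + K / c" for x
  proof -
    have x: "norm x \<ge> 1" "norm x \<ge> K / c" using that \<open>K > 0\<close> c(1)
      by (smt (verit) divide_pos_pos)+
    have "K = c * (K / c)" using c(1) by simp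
    also have "\<dots> \<le> c * (norm x)\<^sup>2"
      using c(1) x self_le_power[of "norm x" 2] by (intro mult_left_mono) auto
    also have "\<dots> \<le> norm_sq F x" using c(2) x by simp
    finally show ?thesis by simp
  qed
  let ?w = "\<lambda>x. - 2 * max 0 (K - norm_sq F x)"
  define I where "I i x = eval_poly (G i * F i) x * cnj (eval_poly ?J x) * complex_of_real (?w x)" for i x
  have phi': "continuous_on UNIV (\<lambda>t. - 2 * max 0 (K - t))" by (intro continuous_intros)
  have I: "integrable lborel (I i)" "integral\<^sup>L lborel (I i) = 0" for i
    unfolding I_def
    using integral_residue_kills_ideal[OF truncated_square_has_derivative[of K] phi', where F = F and R = "1 + K / c"
        and G = "G i" and i = i] far
    by simp_all
  define q where "q x = (cmod (eval_poly ?J x))\<^sup>2 * max 0 (K - norm_sq F x)" for x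
  have "complex_of_real (- 2 * q x) = (\<Sum>i\<in>UNIV. I i x)" for x
  proof -
    have "(\<Sum>i\<in>UNIV. I i x) = eval_poly ?J x * cnj (eval_poly ?J x) * complex_of_real (?w x)"
      unfolding I_def sum_distrib_right[symmetric] eval_sum[symmetric] J[symmetric] ..
    then show ?thesis
      by (simp add: q_def complex_norm_square[symmetric] del: of_real_power)
  qed
  then have qI: "(\<lambda>x. complex_of_real (- 2 * q x)) = (\<lambda>x. \<Sum>i\<in>UNIV. I i x)" by blast
  have cq: "continuous_on UNIV q" unfolding q_def by (intro continuous_intros)
  have iq: "integrable lborel q"
    by (rule integrable_compact_support[OF cq, of "1 + K / c"]) (use far in \<open>simp add: q_def\<close>)
  have "complex_of_real (- 2 * integral\<^sup>L lborel q) = integral\<^sup>L lborel (\<lambda>x. complex_of_real (- 2 * q x))"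
    by simp
  also have "\<dots> = 0" unfolding qI using I by simp
  finally have "integral\<^sup>L lborel q = 0" by simp
  with iq have "q z = 0"
    by (intro continuous_nonneg_integral_eq_0[OF cq]) (auto simp: q_def)
  with z \<open>norm_sq F z < K\<close> show False by (simp add: q_def)
qed

section \<open>Smooth and singular hypersurfaces\<close>

text \<open>
  By Euler's identity a common zero of the partial derivatives is a zero of \<open>f\<close>, and by
  homogeneity the vanishing passes to all coordinate vectors of the point.
\<close>

lemma smooth_hypersurface_iff:
  assumes hom: "homogeneous_poly (Suc (Suc e)) f"
  shows "smooth_hypersurface f \<longleftrightarrow> (\<forall>v. (\<forall>i. eval_poly (partial_deriv i f) v = 0) \<longrightarrow> v = 0)"
proof
  assume smooth: "smooth_hypersurface f"
  show "\<forall>v. (\<forall>i. eval_poly (partial_deriv i f) v = 0) \<longrightarrow> v = 0"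
  proof (intro allI impI, rule ccontr)
    fix v assume crit: "\<forall>i. eval_poly (partial_deriv i f) v = 0" and v: "v \<noteq> 0"
    have "eval_poly (const (of_nat (Suc (Suc e))) * f) v = 0"
      unfolding euler_identity[OF hom, symmetric] using crit by simp
    then have "eval_poly f v = 0" by (simp only: eval_mult eval_const mult_eq_0_iff of_nat_eq_0_iff) simp
    with crit have "eval_poly f (c *s v) = 0" "eval_poly (partial_deriv i f) (c *s v) = 0" for c i
      by (simp_all add: eval_homogeneous_scale[OF hom]
          eval_homogeneous_scale[OF homogeneous_partial[OF hom]])
    then have "proj_rel `` {v} \<in> singular_locus f"
      using v unfolding singular_locus_def proj_space_def
      by (auto intro!: quotientI) (auto simp: proj_rel_def)
    with smooth show False by (simp add: smooth_hypersurface_def)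
  qed
next
  assume crit: "\<forall>v. (\<forall>i. eval_poly (partial_deriv i f) v = 0) \<longrightarrow> v = 0"
  show "smooth_hypersurface f"
    unfolding smooth_hypersurface_def
  proof (rule equals0I)
    fix p assume p: "p \<in> singular_locus f"
    then have "p \<in> (- {0}) // proj_rel" by (simp add: singular_locus_def proj_space_def)
    then obtain v where v: "v \<noteq> 0" "p = proj_rel `` {v}" by (auto elim: quotientE)
    then have "v \<in> p"
      using equiv_class_self[OF equiv_proj_rel, of v] by simp
    with p have "\<forall>i. eval_poly (partial_deriv i f) v = 0" by (auto simp: singular_locus_def)
    with crit v(1) show False by blast
  qed
qed

lemma hessian_poly_eq_jacobian: "hessian_poly f = det (jacobian_matrix (\<lambda>i. partial_deriv i f))"
  unfolding hessian_poly_def jacobian_matrix_def by (simp add: partial_commute)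

theorem proposition3p6:
  fixes n d :: nat and f :: "('n::finite) cpoly"
  assumes "CARD('n) = n + 1" and "n \<ge> 1" and "d \<ge> 2"
    and "homogeneous_poly d f"
  shows "(smooth_hypersurface f \<longrightarrow> hessian_poly f \<notin> jacobian_ideal f) \<and>
         (\<not> smooth_hypersurface f \<and> has_isolated_singularities f \<longrightarrow>
            hessian_poly f \<in> jacobian_ideal f)"
proof (intro conjI impI)
  obtain e where "d = Suc (Suc e)"
    using \<open>d \<ge> 2\<close> by (metis add_2_eq_Suc le_Suc_ex)
  with assms have hom: "homogeneous_poly (Suc (Suc e)) f" by simp
  {
    assume "smooth_hypersurface f"
    then have "v = 0" if "\<And>i. eval_poly (partial_deriv i f) v = 0" for v
      using that unfolding smooth_hypersurface_iff[OF hom] by blast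
    then have "hessian_poly f \<noteq> (\<Sum>i\<in>UNIV. g i * partial_deriv i f)" for g
      unfolding hessian_poly_eq_jacobian
      by (rule jacobian_not_in_ideal[OF homogeneous_partial[OF hom]])
    then show "hessian_poly f \<notin> jacobian_ideal f"
      by (auto simp: jacobian_ideal_def)
  next
    assume "\<not> smooth_hypersurface f \<and> has_isolated_singularities f"
    then obtain v where "v \<noteq> 0" "\<And>i. eval_poly (partial_deriv i f) v = 0"
      unfolding smooth_hypersurface_iff[OF hom] by blast
    then show "hessian_poly f \<in> jacobian_ideal f"
      by (rule hessian_in_jacobian_of_singular[OF hom])
  }
qed

end
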